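(* The set of projections in $M_2(\mathbb{R})$ with all diagonal entries equal to $1/2$ is not connected. For every integer $n>1$, the set of projections in $M_{2n}(\mathbb{R})$ with all diagonal entries equal to $1/2$ is pathwise connected.
   Context: A projection in $M_m(\mathbb{R})$ is a real matrix $p$ with $p=p^{T}=p^2$. The sets carry the topology inherited from the matrix space. *)

theory Defs
  imports "HOL-Analysis.Analysis"
begin

definition is_projection :: "real ^ 'm ^ 'm \<Rightarrow> bool" where
  "is_projection p \<longleftrightarrow> p = transpose p \<and> transpose p = p ** p"

definition half_diag_projections :: "(real ^ 'm ^ 'm) set" where
  "half_diag_projections = {p. is_projection p \<and> (\<forall>i. p $ i $ i = 1 / 2)}"

end

theory Submission
  imports Defs
begin

text \<open>
  Writing \<open>p = (1 + S) / 2\<close>, the projections with diagonal \<open>1/2\<close> correspond to the symmetric involutions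
  \<open>S\<close> with zero diagonal. Let \<open>J\<close> be a diagonal sign matrix with as many \<open>+1\<close> as \<open>-1\<close>, and split
  \<open>S = K + L\<close> into the parts commuting and anticommuting with \<open>J\<close>. Then \<open>KL = -LK\<close> and
  \<open>K\<^sup>2 + L\<^sup>2 = 1\<close>, so on joint eigenvectors \<open>b\<close> of \<open>J\<close> and \<open>K\<close> (with eigenvalues \<open>j\<close>, \<open>k\<close>) one has
  \<open>L b = sqrt (1 - k\<^sup>2) \<sigma>(b)\<close>, where \<open>\<sigma>(b)\<close> has eigenvalues \<open>-j\<close>, \<open>-k\<close>. On \<open>ker L\<close> such a pairing
  \<open>\<sigma>\<close> exists because \<open>tr J = tr S = 0\<close>. The path \<open>b \<mapsto> t k b + sqrt (1 - t\<^sup>2 k\<^sup>2) \<sigma>(b)\<close> consists of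
  symmetric involutions whose diagonal is \<open>t\<close> times that of \<open>S\<close>, that is zero, and it ends at an
  involution \<open>W\<close> anticommuting with \<open>J\<close>.

  Conjugating \<open>W\<close> by rotations inside the \<open>+1\<close>-eigenspace of \<open>J\<close> turns it into a fixed perfect matching
  (a permutation involution) up to the sign of one edge. When there are at least four indices, that
  sign can be changed by rotating in coordinate planes \<open>(i, j)\<close> with \<open>S\<^sub>i\<^sub>j = 0\<close>, which keeps the
  diagonal zero.
\<close>

section \<open>Joint eigenbases of two involutions\<close>

text \<open>A maximizer \<open>x\<close> of the Rayleigh quotient \<open>x \<bullet> T x\<close> on
  the unit sphere of \<open>V\<close> is an eigenvector: invariance of \<open>V\<close> makes the
  residual \<open>T x - \<mu> x\<close> an admissible direction of variation, and maximality forces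
  it to vanish.\<close>

lemma self_adjoint_eigenvector:
  fixes T :: "'a::euclidean_space \<Rightarrow> 'a"
  assumes lin: "linear T" and sa: "\<And>x y. x \<bullet> T y = T x \<bullet> y"
    and V: "subspace V" "T ` V \<subseteq> V" "V \<noteq> {0}"
  obtains x \<mu> where "x \<in> V" "norm x = 1" "T x = \<mu> *\<^sub>R x"
proof -
  interpret T: linear T by fact
  from V(1,3) obtain z where z: "z \<in> V" "z \<noteq> 0"
    using subspace_0 by blast
  let ?U = "sphere 0 1 \<inter> V"
  have "compact ?U"
    using V(1) by (intro compact_Int_closed closed_subspace) auto
  moreover have "z /\<^sub>R norm z \<in> ?U"
    using z V(1) by (simp add: subspace_scale)
  moreover have "continuous_on ?U (\<lambda>x. x \<bullet> T x)"
    by (intro continuous_intros linear_continuous_on linear_conv_bounded_linear[THEN iffD1] lin)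
  ultimately obtain x where x: "x \<in> ?U" and max: "\<And>y. y \<in> ?U \<Longrightarrow> y \<bullet> T y \<le> x \<bullet> T x"
    using continuous_attains_sup[of ?U "\<lambda>x. x \<bullet> T x"] by blast
  define \<mu> where "\<mu> = x \<bullet> T x"
  have xx: "x \<bullet> x = 1" using x by (simp add: dot_square_norm)
  have bound: "y \<bullet> T y \<le> \<mu> * (y \<bullet> y)" if "y \<in> V" for y
  proof (cases "y = 0")
    case False
    have "(y /\<^sub>R norm y) \<bullet> T (y /\<^sub>R norm y) \<le> \<mu>"
      using max[of "y /\<^sub>R norm y"] that V(1) False by (simp add: \<mu>_def subspace_scale)
    then have "(y \<bullet> T y) / (norm y)\<^sup>2 \<le> \<mu>"
      by (simp add: T.scaleR power2_eq_square divide_simps)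
    then show ?thesis using False by (simp add: divide_simps dot_square_norm)
  qed simp
  define h where "h = T x - \<mu> *\<^sub>R x"
  have h: "h \<in> V" using x V by (auto simp: h_def intro!: subspace_diff subspace_scale)
  \<comment> \<open>First variation in the direction of the residual: \<open>bound\<close> at
    \<open>x + t h\<close>, where the constant terms cancel and the term linear in \<open>t\<close>
    is exactly \<open>2 t (h \<bullet> h)\<close>.\<close>
  have quad: "2 * t * (h \<bullet> h) \<le> t\<^sup>2 * (\<mu> * (h \<bullet> h) - h \<bullet> T h)" for t
  proof -
    have "(x + t *\<^sub>R h) \<bullet> T (x + t *\<^sub>R h) \<le> \<mu> * ((x + t *\<^sub>R h) \<bullet> (x + t *\<^sub>R h))"
      using bound x h V(1) by (simp add: subspace_add subspace_scale)
    moreover have "(x + t *\<^sub>R h) \<bullet> T (x + t *\<^sub>R h) = \<mu> + 2 * t * (h \<bullet> T x) + t\<^sup>2 * (h \<bullet> T h)"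
      using sa[of x h]
      by (simp add: T.add T.scaleR inner_add \<mu>_def power2_eq_square inner_commute[of "T x" h] algebra_simps)
    moreover have "(x + t *\<^sub>R h) \<bullet> (x + t *\<^sub>R h) = 1 + 2 * t * (h \<bullet> x) + t\<^sup>2 * (h \<bullet> h)"
      by (simp add: inner_add xx power2_eq_square inner_commute[of x h] algebra_simps)
    moreover have "h \<bullet> T x = h \<bullet> h + \<mu> * (h \<bullet> x)"
      by (simp add: h_def algebra_simps inner_diff)
    ultimately have "\<mu> + 2 * t * (h \<bullet> h + \<mu> * (h \<bullet> x)) + t\<^sup>2 * (h \<bullet> T h)
        \<le> \<mu> * (1 + 2 * t * (h \<bullet> x) + t\<^sup>2 * (h \<bullet> h))"
      by (simp only:)
    then show ?thesis by (simp add: algebra_simps)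
  qed
  have "h \<bullet> h = 0"
  proof (rule ccontr)
    assume "h \<bullet> h \<noteq> 0"
    then have pos: "h \<bullet> h > 0" by (simp add: order_less_le)
    \<comment> \<open>\<open>c\<close> is positive and dominates the coefficient of
      \<open>t\<^sup>2\<close>; with this \<open>t\<close> the right side is at most
      \<open>t (h \<bullet> h)\<close>, half of the left side.\<close>
    define c where "c = \<bar>\<mu> * (h \<bullet> h) - h \<bullet> T h\<bar> + 1"
    define t where "t = (h \<bullet> h) / c"
    have c: "c > 0" by (simp add: c_def add_nonneg_pos)
    have t: "t > 0" using pos c by (simp add: t_def)
    have "2 * t * (h \<bullet> h) \<le> t\<^sup>2 * c"
      by (rule order_trans[OF quad mult_left_mono]) (auto simp: c_def)
    also have "t\<^sup>2 * c = t * (h \<bullet> h)" using c by (simp add: t_def power2_eq_square)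
    finally show False using t pos by (simp add: mult_pos_pos)
  qed
  then have "T x = \<mu> *\<^sub>R x" by (simp add: h_def)
  with x show ?thesis by (intro that[of x \<mu>]) auto
qed

lemma commuting_involution_joint_eigenvector:
  fixes T J :: "'a::euclidean_space \<Rightarrow> 'a"
  assumes lin: "linear T" "linear J" and sa: "\<And>x y. x \<bullet> T y = T x \<bullet> y"
    and JJ: "\<And>x. J (J x) = x" and comm: "\<And>x. T (J x) = J (T x)"
    and V: "subspace V" "T ` V \<subseteq> V" "J ` V \<subseteq> V" "V \<noteq> {0}"
  obtains x j \<mu> where "x \<in> V" "norm x = 1" "J x = j *\<^sub>R x" "T x = \<mu> *\<^sub>R x"
proof -
  interpret T: linear T by fact
  interpret J: linear J by fact
  obtain x \<mu> where x: "x \<in> V" "norm x = 1" "T x = \<mu> *\<^sub>R x"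
    using self_adjoint_eigenvector[OF lin(1) sa V(1,2,4)] by blast
  \<comment> \<open>Up to a factor, \<open>x + J x\<close> is the projection of \<open>x\<close>
    onto the +1 eigenspace of \<open>J\<close>, and commutation keeps it in the
    \<open>\<mu>\<close>-eigenspace of \<open>T\<close>. If it vanishes, \<open>x\<close> itself has
    \<open>J\<close>-eigenvalue -1.\<close>
  have "\<exists>y j. y \<in> V \<and> y \<noteq> 0 \<and> J y = j *\<^sub>R y \<and> T y = \<mu> *\<^sub>R y"
  proof (cases "x + J x = 0")
    case True
    then have "J x = - x" by (simp add: add_eq_0_iff)
    then show ?thesis using x by (intro exI[of _ x] exI[of _ "-1"]) auto
  next
    case False
    then show ?thesis using x V
      by (intro exI[of _ "x + J x"] exI[of _ 1])
        (auto simp: J.add JJ T.add comm J.scaleR algebra_simps intro!: subspace_add)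
  qed
  then obtain y j where y: "y \<in> V" "y \<noteq> 0" "J y = j *\<^sub>R y" "T y = \<mu> *\<^sub>R y" by blast
  show ?thesis
    by (rule that[of "y /\<^sub>R norm y" j \<mu>]) (use y V(1) in \<open>auto simp: J.scaleR T.scaleR subspace_scale\<close>)
qed

section \<open>Orthonormal bases and the trace\<close>

lemma orthonormal_basis_Parseval:
  fixes B :: "'a::euclidean_space set"
  assumes "finite B" "pairwise orthogonal B" "\<And>b. b \<in> B \<Longrightarrow> norm b = 1" "span B = UNIV"
  shows "x \<bullet> y = (\<Sum>b\<in>B. (b \<bullet> x) * (b \<bullet> y))"
proof -
  have "x \<bullet> y = (\<Sum>b\<in>B. (x \<bullet> b) *\<^sub>R b) \<bullet> y"
    using orthonormal_basis_expand[OF assms(2,3) _ assms(1), of x] assms(4)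
    by (simp add: inner_commute)
  also have "\<dots> = (\<Sum>b\<in>B. (b \<bullet> x) * (b \<bullet> y))"
    by (simp add: inner_sum_left inner_commute[of x])
  finally show ?thesis .
qed

text \<open>Expanding \<open>b\<close> in \<open>Basis\<close> and swapping the two sums leaves, for
  each \<open>e\<close>, a Parseval sum over \<open>B\<close>.\<close>

lemma trace_orthonormal_basis:
  fixes B :: "'a::euclidean_space set"
  assumes B: "finite B" "pairwise orthogonal B" "\<And>b. b \<in> B \<Longrightarrow> norm b = 1" "span B = UNIV"
    and lin: "linear T"
  shows "(\<Sum>b\<in>B. b \<bullet> T b) = (\<Sum>e\<in>Basis. e \<bullet> T e)"
proof -
  interpret T: linear T by fact
  have "b \<bullet> T b = (\<Sum>e\<in>Basis. (b \<bullet> e) * (b \<bullet> T e))" for b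
  proof -
    have "b \<bullet> T b = b \<bullet> T (\<Sum>e\<in>Basis. (b \<bullet> e) *\<^sub>R e)"
      by (simp only: euclidean_representation)
    then show ?thesis by (simp add: T.sum T.scaleR inner_sum_right)
  qed
  then have "(\<Sum>b\<in>B. b \<bullet> T b) = (\<Sum>b\<in>B. \<Sum>e\<in>Basis. (b \<bullet> e) * (b \<bullet> T e))"
    by (rule sum.cong[OF refl])
  also have "\<dots> = (\<Sum>e\<in>Basis. \<Sum>b\<in>B. (b \<bullet> e) * (b \<bullet> T e))" by (rule sum.swap)
  also have "\<dots> = (\<Sum>e\<in>Basis. e \<bullet> T e)"
    by (rule sum.cong[OF refl]) (rule orthonormal_basis_Parseval[OF B, symmetric])
  finally show ?thesis .
qed

lemma equal_card_swap:
  assumes fin: "finite A" "finite B" and eq: "card A = card B" and disj: "A \<inter> B = {}"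
  obtains \<tau> where "\<And>x. x \<in> A \<Longrightarrow> \<tau> x \<in> B" "\<And>x. x \<in> B \<Longrightarrow> \<tau> x \<in> A"
    "\<And>x. x \<in> A \<union> B \<Longrightarrow> \<tau> (\<tau> x) = x"
proof -
  obtain g where g: "bij_betw g A B" using finite_same_card_bij[OF fin eq] by blast
  define \<tau> where "\<tau> x = (if x \<in> A then g x else the_inv_into A g x)" for x
  have 1: "\<tau> x \<in> B" if "x \<in> A" for x using g that by (auto simp: \<tau>_def bij_betw_def)
  have 2: "\<tau> x \<in> A" if "x \<in> B" for x
    using g that disj by (auto simp: \<tau>_def bij_betw_def the_inv_into_into)
  have 3: "\<tau> (\<tau> x) = x" if "x \<in> A \<union> B" for x
  proof (cases "x \<in> A")
    case True
    then show ?thesis using 1[OF True] disj g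
      by (auto simp: \<tau>_def bij_betw_def the_inv_into_f_f)
  next
    case False
    with that have "x \<in> B" by simp
    then show ?thesis using 2[OF \<open>x \<in> B\<close>] False g
      by (auto simp: \<tau>_def bij_betw_def f_the_inv_into_f)
  qed
  show ?thesis by (rule that[OF 1 2 3])
qed

section \<open>The parts of one involution that commute and anticommute with another\<close>

locale involution_pair =
  fixes S J :: "'a::euclidean_space \<Rightarrow> 'a"
  assumes lin_S: "linear S" and lin_J: "linear J"
    and sa_S: "x \<bullet> S y = S x \<bullet> y" and sa_J: "x \<bullet> J y = J x \<bullet> y"
    and SS [simp]: "S (S x) = x" and JJ [simp]: "J (J x) = x"
begin

sublocale S: linear S by (rule lin_S)
sublocale J: linear J by (rule lin_J)

definition K :: "'a \<Rightarrow> 'a" where "K x = (1/2) *\<^sub>R (S x + J (S (J x)))"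
definition L :: "'a \<Rightarrow> 'a" where "L x = (1/2) *\<^sub>R (S x - J (S (J x)))"

lemma lin_K: "linear K"
  by (rule linearI) (simp_all add: K_def S.add J.add S.scaleR J.scaleR algebra_simps)

lemma lin_L: "linear L"
  by (rule linearI) (simp_all add: L_def S.add J.add S.scaleR J.scaleR algebra_simps)

sublocale K: linear K by (rule lin_K)
sublocale L: linear L by (rule lin_L)

lemma sa_K: "x \<bullet> K y = K x \<bullet> y"
  by (simp add: K_def inner_add sa_S sa_J)

lemma sa_L: "x \<bullet> L y = L x \<bullet> y"
  by (simp add: L_def inner_diff sa_S sa_J)

lemma S_eq_K_L: "S x = K x + L x"
proof -
  have "K x + L x = (1/2 + 1/2) *\<^sub>R S x"
    unfolding scaleR_add_left by (simp add: K_def L_def scaleR_add_right scaleR_diff_right)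
  then show ?thesis by simp
qed

lemma K_J: "K (J x) = J (K x)"
  by (simp add: K_def J.add J.scaleR algebra_simps)

lemma L_J: "L (J x) = - J (L x)"
  by (simp add: L_def J.diff J.scaleR algebra_simps)

lemma K_L: "K (L x) = - L (K x)"
  by (simp add: K_def L_def S.add J.add S.diff J.diff J.scaleR S.scaleR algebra_simps)

lemma K_K_L_L: "K (K x) + L (L x) = x"
proof -
  \<comment> \<open>The mixed products of \<open>S\<close> and \<open>J S J\<close> cancel between
    the two squares; each square contributes one quarter from \<open>S S\<close> and one from
    \<open>(J S J) (J S J)\<close>.\<close>
  have "K (K x) + L (L x) = (1/4 + 1/4 + 1/4 + 1/4) *\<^sub>R x"
    unfolding scaleR_add_left
    by (simp add: K_def L_def S.add J.add S.diff J.diff J.scaleR S.scaleR algebra_simps)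
  then show ?thesis by simp
qed

lemma L_L_eigenvector:
  assumes "K x = k *\<^sub>R x"
  shows "L (L x) = (1 - k\<^sup>2) *\<^sub>R x"
  using K_K_L_L[of x] assms by (simp add: K.scaleR algebra_simps power2_eq_square)

lemma norm_L_eigenvector:
  assumes "K x = k *\<^sub>R x" "norm x = 1"
  shows "(norm (L x))\<^sup>2 = 1 - k\<^sup>2"
proof -
  have "(norm (L x))\<^sup>2 = x \<bullet> L (L x)"
    by (simp add: sa_L dot_square_norm)
  then show ?thesis using assms by (simp add: L_L_eigenvector[OF assms(1)] dot_square_norm)
qed

lemma J_eigenvalue:
  assumes "J x = j *\<^sub>R x" "norm x = 1"
  shows "j\<^sup>2 = 1"
proof -
  have "j\<^sup>2 = J x \<bullet> J x"
    using assms by (simp add: power2_eq_square dot_square_norm)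
  also have "\<dots> = x \<bullet> x" using sa_J[of x "J x"] by simp
  finally show ?thesis using assms by (simp add: dot_square_norm)
qed

text \<open>If \<open>L b = 0\<close>, the last condition is vacuous: \<open>c = b\<close> will do.\<close>
definition paired :: "'a set \<Rightarrow> bool" where
  "paired B \<longleftrightarrow> finite B \<and> pairwise orthogonal B \<and>
    (\<forall>b\<in>B. norm b = 1 \<and> (\<exists>j. J b = j *\<^sub>R b) \<and> (\<exists>k. K b = k *\<^sub>R b) \<and>
      (\<exists>c\<in>B. L b = norm (L b) *\<^sub>R c))"

text \<open>In a paired family of maximal size, the orthogonal complement \<open>V\<close> is
  invariant under \<open>J\<close>, \<open>K\<close> and \<open>L\<close>. If \<open>V\<close> were
  nonzero, it would contain a joint eigenvector \<open>x\<close> of \<open>J\<close> and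
  \<open>K\<close>, and adding \<open>x\<close>, together with the normalized \<open>L x\<close>
  when that is nonzero, would enlarge the family.\<close>

lemma paired_spanning: "\<exists>B. paired B \<and> span B = UNIV"
proof -
  have card: "card B \<le> DIM('a)" if "paired B" for B
  proof -
    have "independent B" using that
      by (intro pairwise_orthogonal_independent) (auto simp: paired_def)
    then show ?thesis by (simp add: independent_card_le)
  qed
  have "paired {}" by (simp add: paired_def)
  then have "\<exists>B. paired B \<and> (\<forall>B'. paired B' \<longrightarrow> card B' \<le> card B)"
    using card by (intro ex_has_greatest_nat[where b = "Suc DIM('a)"]) (auto simp: less_Suc_eq_le)
  then obtain B where B: "paired B" and max: "\<And>B'. paired B' \<Longrightarrow> card B' \<le> card B"
    by iprover
  define V where "V = {x. \<forall>b\<in>B. b \<bullet> x = 0}"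
  have subV: "subspace V" by (simp add: V_def subspace_def inner_add)
  have inv: "f ` V \<subseteq> V"
    if "\<And>b x. b \<in> B \<Longrightarrow> x \<in> V \<Longrightarrow> f b \<bullet> x = 0" and "\<And>x y. x \<bullet> f y = f x \<bullet> y" for f
    using that by (auto simp: V_def)
  have JV: "J ` V \<subseteq> V"
  proof (rule inv[OF _ sa_J])
    fix b x assume "b \<in> B" "x \<in> V"
    moreover from this obtain j where "J b = j *\<^sub>R b" using B by (auto simp: paired_def)
    ultimately show "J b \<bullet> x = 0" by (simp add: V_def)
  qed
  have KV: "K ` V \<subseteq> V"
  proof (rule inv[OF _ sa_K])
    fix b x assume "b \<in> B" "x \<in> V"
    moreover from this obtain k where "K b = k *\<^sub>R b" using B by (auto simp: paired_def)
    ultimately show "K b \<bullet> x = 0" by (simp add: V_def)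
  qed
  have LV: "L ` V \<subseteq> V"
  proof (rule inv[OF _ sa_L])
    fix b x assume *: "b \<in> B" "x \<in> V"
    then obtain c where c: "c \<in> B" "L b = norm (L b) *\<^sub>R c" using B by (auto simp: paired_def)
    have "L b \<bullet> x = norm (L b) * (c \<bullet> x)" by (subst c(2)) simp
    then show "L b \<bullet> x = 0" using * c(1) by (simp add: V_def)
  qed
  have "V = {0}"
  proof (rule ccontr)
    assume "V \<noteq> {0}"
    then obtain x j k where x: "x \<in> V" "norm x = 1" "J x = j *\<^sub>R x" "K x = k *\<^sub>R x"
      using commuting_involution_joint_eigenvector[OF lin_K lin_J sa_K JJ K_J subV KV JV] by blast
    have orth: "orthogonal b y" "orthogonal y b" if "b \<in> B" "y \<in> V" for b y
      using that by (auto simp: V_def orthogonal_def inner_commute)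
    have notin: "y \<notin> B" if "y \<in> V" "norm y = 1" for y
      using that orth[of y y] by (auto simp: orthogonal_self)
    show False
    proof (cases "L x = 0")
      case True
      have "paired (insert x B)"
        using B x True orth[OF _ x(1)]
        by (auto simp: paired_def pairwise_insert)
      moreover have "card (insert x B) = Suc (card B)"
        using B notin[OF x(1,2)] by (simp add: paired_def)
      ultimately show False using max[of "insert x B"] by simp
    next
      case False
      \<comment> \<open>\<open>L\<close> exchanges \<open>x\<close> and \<open>c\<close> up to the
        factor \<open>norm (L x)\<close>, so the family stays closed under \<open>L\<close>; since
        \<open>L\<close> anticommutes with \<open>J\<close> and \<open>K\<close>, \<open>c\<close>
        has both eigenvalues negated.\<close>
      define c where "c = L x /\<^sub>R norm (L x)"
      have Lx: "L x = norm (L x) *\<^sub>R c" using False by (simp add: c_def)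
      have c: "c \<in> V" "norm c = 1" using x LV subV False by (auto simp: c_def intro!: subspace_scale)
      have Jc: "J c = (- j) *\<^sub>R c"
      proof -
        have "J (L x) = (- j) *\<^sub>R L x"
          using L_J[of x] x by (simp add: L.scaleR)
        then show ?thesis by (simp add: c_def J.scaleR)
      qed
      have Kc: "K c = (- k) *\<^sub>R c"
        using K_L[of x] x by (simp add: c_def K.scaleR L.scaleR)
      have Lc: "L c = norm (L x) *\<^sub>R x"
      proof -
        have "L (L x) = (norm (L x) * norm (L x)) *\<^sub>R x"
          using L_L_eigenvector[OF x(4)] norm_L_eigenvector[OF x(4,2)] by (simp add: power2_eq_square)
        then show ?thesis using False by (simp add: c_def L.scaleR)
      qed
      then have nLc: "norm (L c) = norm (L x)" using x by simp
      \<comment> \<open>\<open>x\<close> and \<open>c\<close> are orthogonal because their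
        \<open>J\<close>-eigenvalues \<open>j\<close> and \<open>-j\<close> differ, \<open>j\<close>
        being a sign.\<close>
      have "x \<bullet> J c = J x \<bullet> c" by (rule sa_J)
      then have "j * (x \<bullet> c) = 0" using Jc x(3) by simp
      then have xc: "x \<bullet> c = 0" using J_eigenvalue[OF x(3,2)] by auto
      then have "x \<noteq> c" using x by (auto simp: dot_square_norm)
      have exJc: "\<exists>j. J c = j *\<^sub>R c" and exKc: "\<exists>k. K c = k *\<^sub>R c"
        using Jc Kc by blast+
      have "paired (insert x (insert c B))"
        unfolding paired_def
      proof (intro conjI ballI)
        show "finite (insert x (insert c B))" using B by (simp add: paired_def)
        show "pairwise orthogonal (insert x (insert c B))"
          using B xc orth[OF _ x(1)] orth[OF _ c(1)]
          by (auto simp: paired_def pairwise_insert orthogonal_def inner_commute)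
        fix b assume b: "b \<in> insert x (insert c B)"
        show "norm b = 1" using b B x c by (auto simp: paired_def)
        show "\<exists>j. J b = j *\<^sub>R b" "\<exists>k. K b = k *\<^sub>R b" 
          using b B x(3,4) exJc exKc by (auto simp only: paired_def insert_iff)
        show "\<exists>d\<in>insert x (insert c B). L b = norm (L b) *\<^sub>R d"
          using b B Lx Lc nLc by (auto simp: paired_def)
      qed
      moreover have "card (insert x (insert c B)) = Suc (Suc (card B))"
        using B notin[OF x(1,2)] notin[OF c] \<open>x \<noteq> c\<close> by (simp add: paired_def)
      ultimately show False using max[of "insert x (insert c B)"] by simp
    qed
  qed
  have "span B = UNIV"
  proof (rule ccontr)
    assume "span B \<noteq> UNIV"
    then have "dim B < DIM('a)"
      using dim_eq_full[of B] dim_subset_UNIV[of B] by linarith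
    then obtain x where "x \<noteq> 0" "\<And>y. y \<in> span B \<Longrightarrow> orthogonal x y"
      using orthogonal_to_subspace_exists by blast
    then have "x \<in> V" by (auto simp: V_def orthogonal_def inner_commute span_base)
    with \<open>V = {0}\<close> \<open>x \<noteq> 0\<close> show False by simp
  qed
  with B show ?thesis by blast
qed

end

text \<open>The function \<open>(j + k) / 2\<close> is 1 on the class with signs (1, 1), -1 on (-1,
  -1) and 0 elsewhere, so vanishing sums give these two classes equal size. Likewise
  \<open>(j - k) / 2\<close> balances the two mixed classes. Swapping within each pair of classes
  negates both signs.\<close>

lemma sign_balanced_involution:
  fixes j k :: "'a \<Rightarrow> real"
  assumes fin: "finite C" and sq: "\<And>b. b \<in> C \<Longrightarrow> (j b)\<^sup>2 = 1" "\<And>b. b \<in> C \<Longrightarrow> (k b)\<^sup>2 = 1"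
    and sums: "sum j C = 0" "sum k C = 0"
  obtains \<tau> where "\<And>b. b \<in> C \<Longrightarrow> \<tau> b \<in> C" "\<And>b. b \<in> C \<Longrightarrow> \<tau> (\<tau> b) = b"
    "\<And>b. b \<in> C \<Longrightarrow> j (\<tau> b) = - j b" "\<And>b. b \<in> C \<Longrightarrow> k (\<tau> b) = - k b"
proof -
  define E where "E p q = {b\<in>C. j b = p \<and> k b = q}" for p q
  have signs: "(j b = 1 \<or> j b = -1) \<and> (k b = 1 \<or> k b = -1)" if "b \<in> C" for b
    using sq[OF that] by (simp add: power2_eq_1_iff)
  have card: "real (card (E p q)) = (\<Sum>b\<in>C. of_bool (j b = p \<and> k b = q))" for p q
    unfolding of_bool_def by (simp add: E_def flip: sum.inter_filter[OF fin])
  have "real (card (E 1 1)) - real (card (E (-1) (-1))) = (\<Sum>b\<in>C. (j b + k b) / 2)"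
    unfolding card sum_subtractf[symmetric] by (rule sum.cong[OF refl]) (use signs in force)
  also have "\<dots> = 0"
    using sums by (simp add: sum.distrib flip: sum_divide_distrib)
  finally have c1: "card (E 1 1) = card (E (-1) (-1))" by simp
  have "real (card (E 1 (-1))) - real (card (E (-1) 1)) = (\<Sum>b\<in>C. (j b - k b) / 2)"
    unfolding card sum_subtractf[symmetric] by (rule sum.cong[OF refl]) (use signs in force)
  also have "\<dots> = 0"
    using sums by (simp add: sum_subtractf flip: sum_divide_distrib)
  finally have c2: "card (E 1 (-1)) = card (E (-1) 1)" by simp
  have finE: "finite (E p q)" for p q using fin by (simp add: E_def)
  have disj: "E 1 1 \<inter> E (-1) (-1) = {}" "E 1 (-1) \<inter> E (-1) 1 = {}" by (auto simp: E_def)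
  obtain \<tau>1 where \<tau>1: "\<And>x. x \<in> E 1 1 \<Longrightarrow> \<tau>1 x \<in> E (-1) (-1)" "\<And>x. x \<in> E (-1) (-1) \<Longrightarrow> \<tau>1 x \<in> E 1 1"
    "\<And>x. x \<in> E 1 1 \<union> E (-1) (-1) \<Longrightarrow> \<tau>1 (\<tau>1 x) = x"
    using equal_card_swap[OF finE finE c1 disj(1)] by blast
  obtain \<tau>2 where \<tau>2: "\<And>x. x \<in> E 1 (-1) \<Longrightarrow> \<tau>2 x \<in> E (-1) 1" "\<And>x. x \<in> E (-1) 1 \<Longrightarrow> \<tau>2 x \<in> E 1 (-1)"
    "\<And>x. x \<in> E 1 (-1) \<union> E (-1) 1 \<Longrightarrow> \<tau>2 (\<tau>2 x) = x"
    using equal_card_swap[OF finE finE c2 disj(2)] by blast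
  define \<tau> where "\<tau> b = (if j b = k b then \<tau>1 b else \<tau>2 b)" for b
  have "\<tau> b \<in> C \<and> \<tau> (\<tau> b) = b \<and> j (\<tau> b) = - j b \<and> k (\<tau> b) = - k b" if b: "b \<in> C" for b
  proof -
    consider "b \<in> E 1 1" | "b \<in> E (-1) (-1)" | "b \<in> E 1 (-1)" | "b \<in> E (-1) 1"
      using signs[OF b] b by (auto simp: E_def)
    then show ?thesis
    proof cases
      case 1
      then show ?thesis using \<tau>1(1)[of b] \<tau>1(3)[of b] by (auto simp: E_def \<tau>_def)
    next
      case 2
      then show ?thesis using \<tau>1(2)[of b] \<tau>1(3)[of b] by (auto simp: E_def \<tau>_def)
    next
      case 3
      then show ?thesis using \<tau>2(1)[of b] \<tau>2(3)[of b] by (auto simp: E_def \<tau>_def)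
    next
      case 4
      then show ?thesis using \<tau>2(2)[of b] \<tau>2(3)[of b] by (auto simp: E_def \<tau>_def)
    qed
  qed
  then show ?thesis by (intro that[of \<tau>]) auto
qed

section \<open>The joint eigenbasis with its sign-reversing pairing\<close>

context involution_pair
begin

text \<open>Off the kernel of \<open>L\<close> the pairing is the normalized \<open>L\<close>. It
  reverses both signs, so these vectors contribute nothing to either trace; the vanishing traces
  therefore balance the signs on the kernel, where a pairing can then be chosen.\<close>

lemma paired_eigenbasis:
  assumes trS: "(\<Sum>e\<in>Basis. e \<bullet> S e) = 0" and trJ: "(\<Sum>e\<in>Basis. e \<bullet> J e) = 0"
  obtains B \<sigma> where "finite B" "pairwise orthogonal B" "\<And>b. b \<in> B \<Longrightarrow> norm b = 1" "span B = UNIV"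
    "\<And>b. b \<in> B \<Longrightarrow> J b = (b \<bullet> J b) *\<^sub>R b"
    "\<And>b. b \<in> B \<Longrightarrow> S b = (b \<bullet> S b) *\<^sub>R b + sqrt (1 - (b \<bullet> S b)\<^sup>2) *\<^sub>R \<sigma> b"
    "\<And>b. b \<in> B \<Longrightarrow> (b \<bullet> S b)\<^sup>2 \<le> 1"
    "\<And>b. b \<in> B \<Longrightarrow> \<sigma> b \<in> B" "\<And>b. b \<in> B \<Longrightarrow> \<sigma> (\<sigma> b) = b"
    "\<And>b. b \<in> B \<Longrightarrow> \<sigma> b \<bullet> J (\<sigma> b) = - (b \<bullet> J b)"
    "\<And>b. b \<in> B \<Longrightarrow> \<sigma> b \<bullet> S (\<sigma> b) = - (b \<bullet> S b)"
proof -
  obtain B where "paired B" and span: "span B = UNIV" using paired_spanning by blast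
  then have fin: "finite B" and orth: "pairwise orthogonal B" and norm1: "\<And>b. b \<in> B \<Longrightarrow> norm b = 1"
    and exJ: "\<And>b. b \<in> B \<Longrightarrow> \<exists>j. J b = j *\<^sub>R b" and exK: "\<And>b. b \<in> B \<Longrightarrow> \<exists>k. K b = k *\<^sub>R b"
    and exL: "\<And>b. b \<in> B \<Longrightarrow> \<exists>c\<in>B. L b = norm (L b) *\<^sub>R c"
    by (auto simp: paired_def)
  define j where "j b = b \<bullet> J b" for b
  define k where "k b = b \<bullet> S b" for b
  have J: "J b = j b *\<^sub>R b" if "b \<in> B" for b
    using exJ[OF that] norm1[OF that] by (auto simp: j_def dot_square_norm)
  have jj: "(j b)\<^sup>2 = 1" if "b \<in> B" for b
    by (rule J_eigenvalue[OF J[OF that] norm1[OF that]])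
  have K: "K b = k b *\<^sub>R b" if b: "b \<in> B" for b
  proof -
    \<comment> \<open>Conjugation by \<open>J\<close> does not change the diagonal entry of
      \<open>S\<close> at a \<open>J\<close>-eigenvector, so the \<open>K\<close>-eigenvalue can be
      read off from \<open>S\<close>.\<close>
    have "b \<bullet> J (S (J b)) = (j b)\<^sup>2 * (b \<bullet> S b)"
      using J[OF b] by (simp add: sa_J S.scaleR power2_eq_square)
    then have "b \<bullet> K b = k b"
      using jj[OF b] by (simp add: K_def inner_add k_def)
    then show ?thesis using exK[OF b] norm1[OF b] by (auto simp: dot_square_norm)
  qed
  have nL: "(norm (L b))\<^sup>2 = 1 - (k b)\<^sup>2" if "b \<in> B" for b
    by (rule norm_L_eigenvector[OF K[OF that] norm1[OF that]])
  then have k1: "(k b)\<^sup>2 \<le> 1" if "b \<in> B" for b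
    using that zero_le_power2[of "norm (L b)"] by fastforce
  have sqrtL: "norm (L b) = sqrt (1 - (k b)\<^sup>2)" if "b \<in> B" for b
    using nL[OF that] by (simp add: real_sqrt_unique)
  define C where "C = {b\<in>B. L b = 0}"
  define s where "s b = L b /\<^sub>R norm (L b)" for b
  have s: "s b \<in> B - C \<and> s (s b) = b \<and> j (s b) = - j b \<and> k (s b) = - k b" if "b \<in> B - C" for b
  proof -
    have b: "b \<in> B" "L b \<noteq> 0" using that by (auto simp: C_def)
    then obtain c where c: "c \<in> B" "L b = norm (L b) *\<^sub>R c" using exL by blast
    have sc: "s b = c" using b c(2) by (simp add: s_def) (metis c(2) inverse_nonzero_iff_nonzero left_inverse norm_eq_zero scaleR_one scaleR_scaleR)
    have "L (L b) = (norm (L b) * norm (L b)) *\<^sub>R b"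
      using L_L_eigenvector[OF K[OF b(1)]] nL[OF b(1)] by (simp add: power2_eq_square)
    then have Ls: "L (s b) = norm (L b) *\<^sub>R b" using b by (simp add: s_def L.scaleR)
    then have nLs: "norm (L (s b)) = norm (L b)" using norm1[OF b(1)] by simp
    have "s (s b) = b" using b(2) by (simp add: s_def[of "s b"] nLs) (simp add: Ls)
    moreover have sB: "s b \<in> B - C" using sc c(1) Ls b norm1[OF b(1)] by (auto simp: C_def)
    moreover have "j (s b) = - j b"
    proof -
      have "J (L b) = (- j b) *\<^sub>R L b"
        using L_J[of b] J[OF b(1)] by (simp add: L.scaleR)
      then have "J (s b) = (- j b) *\<^sub>R s b" by (simp add: s_def J.scaleR)
      then have "s b \<bullet> J (s b) = s b \<bullet> ((- j b) *\<^sub>R s b)" by (rule arg_cong)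
      then show ?thesis using sB norm1[of "s b"] by (simp add: j_def[of "s b"] dot_square_norm)
    qed
    moreover have "k (s b) = - k b"
    proof -
      have "K (L b) = (- k b) *\<^sub>R L b"
        using K_L[of b] K[OF b(1)] by (simp add: L.scaleR)
      then have "K (s b) = (- k b) *\<^sub>R s b" by (simp add: s_def K.scaleR)
      then have "k (s b) *\<^sub>R s b = (- k b) *\<^sub>R s b" using K[of "s b"] sB by simp
      moreover have "norm (s b) = 1" using sB norm1[of "s b"] by simp
      then have "s b \<noteq> 0" by auto
      ultimately show ?thesis by (simp only: scaleR_cancel_right simp_thms)
    qed
    ultimately show ?thesis by blast
  qed
  have bal: "sum f C = 0" if "sum f B = 0" "\<And>b. b \<in> B - C \<Longrightarrow> f (s b) = - f b" for f :: "'a \<Rightarrow> real"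
  proof -
    have "sum f (B - C) = (\<Sum>b\<in>B - C. f (s b))"
      by (rule sum.reindex_bij_witness[of _ s s]) (use s in auto)
    also have "\<dots> = - sum f (B - C)" using that(2) by (simp add: sum_negf)
    finally have "sum f (B - C) = 0" by simp
    moreover have "sum f B = sum f (B - C) + sum f C"
      using fin by (intro sum.subset_diff) (auto simp: C_def)
    ultimately show ?thesis using that(1) by simp
  qed
  have "sum j B = 0"
    using trace_orthonormal_basis[OF fin orth norm1 span lin_J] trJ by (simp add: j_def)
  then have jC: "sum j C = 0" using s by (intro bal) auto
  have "sum k B = 0"
    using trace_orthonormal_basis[OF fin orth norm1 span lin_S] trS by (simp add: k_def)
  then have kC: "sum k C = 0" using s by (intro bal) auto
  have C: "finite C" "C \<subseteq> B" using fin by (auto simp: C_def)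
  \<comment> \<open>On the kernel of \<open>L\<close> the \<open>K\<close>-eigenvalues are signs as
    well, because \<open>norm (L b)\<close> squared is \<open>1 - (k b)\<^sup>2\<close>.\<close>
  have kk: "(k b)\<^sup>2 = 1" if "b \<in> C" for b using nL[of b] that by (simp add: C_def)
  obtain \<tau> where \<tau>: "\<And>b. b \<in> C \<Longrightarrow> \<tau> b \<in> C" "\<And>b. b \<in> C \<Longrightarrow> \<tau> (\<tau> b) = b"
    "\<And>b. b \<in> C \<Longrightarrow> j (\<tau> b) = - j b" "\<And>b. b \<in> C \<Longrightarrow> k (\<tau> b) = - k b"
    using sign_balanced_involution[of C j k] C jj kk jC kC by blast
  define \<sigma> where "\<sigma> b = (if b \<in> C then \<tau> b else s b)" for b
  have \<sigma>: "\<sigma> b \<in> B \<and> \<sigma> (\<sigma> b) = b \<and> j (\<sigma> b) = - j b \<and> k (\<sigma> b) = - k b" if "b \<in> B" for b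
    using \<tau>[of b] s[of b] that C by (auto simp: \<sigma>_def)
  have Sb: "S b = k b *\<^sub>R b + sqrt (1 - (k b)\<^sup>2) *\<^sub>R \<sigma> b" if b: "b \<in> B" for b
  proof -
    \<comment> \<open>On \<open>C\<close> the coefficient is zero, so \<open>S\<close> does not see
      the choice of \<open>\<tau>\<close> there; it becomes visible once \<open>k\<close> is scaled
      by \<open>t < 1\<close>.\<close>
    have "L b = sqrt (1 - (k b)\<^sup>2) *\<^sub>R \<sigma> b"
    proof (cases "b \<in> C")
      case True
      then show ?thesis using kk[OF True] by (simp add: C_def)
    next
      case False
      then show ?thesis using b by (simp add: C_def \<sigma>_def s_def flip: sqrtL[OF b])
    qed
    then show ?thesis using S_eq_K_L[of b] K[OF b] by simp
  qed
  show ?thesis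
    using that[of B \<sigma>, folded j_def k_def] fin orth norm1 span J Sb k1 \<sigma> by blast
qed

end

section \<open>Hollow symmetric involutions\<close>

definition hollow_involutions :: "(real ^ 'm ^ 'm) set" where
  "hollow_involutions = {S. transpose S = S \<and> S ** S = mat 1 \<and> (\<forall>i. S $ i $ i = 0)}"

text \<open>The diagonal sign matrix \<open>J\<close> of the overview, as an operator.\<close>

definition reflect :: "'m set \<Rightarrow> real ^ 'm \<Rightarrow> real ^ 'm" where
  "reflect I x = (\<chi> i. if i \<in> I then x $ i else - x $ i)"

lemma linear_reflect: "linear (reflect I)"
  by (rule linearI) (auto simp: reflect_def vec_eq_iff)

lemma reflect_reflect [simp]: "reflect I (reflect I x) = x"
  by (simp add: reflect_def vec_eq_iff)

lemma reflect_inner: "x \<bullet> reflect I y = reflect I x \<bullet> y"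
  unfolding reflect_def inner_vec_def by (rule sum.cong) auto

lemma symmetric_matrix_inner:
  fixes S :: "real ^ 'm ^ 'm"
  assumes "transpose S = S"
  shows "x \<bullet> (S *v y) = (S *v x) \<bullet> y"
  using assms by (metis dot_lmul_matrix vector_transpose_matrix)

lemma hollow_involutionsI:
  fixes S :: "real ^ 'm ^ 'm"
  assumes "\<And>x y. S $ x $ y = S $ y $ x" "\<And>x. S *v (S *v x) = x" "\<And>x. S $ x $ x = 0"
  shows "S \<in> hollow_involutions"
  using assms by (simp add: hollow_involutions_def transpose_def vec_eq_iff[of "\<chi> i j. S $ j $ i"]
    vec_eq_iff[of "\<chi> j. S $ j $ _"] matrix_eq flip: matrix_vector_mul_assoc)

lemma hollow_involutionsD:
  fixes S :: "real ^ 'm ^ 'm"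
  assumes "S \<in> hollow_involutions"
  shows "transpose S = S" "S *v (S *v x) = x" "S $ i $ i = 0"
  using assms by (simp_all add: hollow_involutions_def matrix_vector_mul_assoc)

lemma entry_inner_axis: "(S :: real ^ 'm ^ 'm) $ i $ j = axis i 1 \<bullet> (S *v axis j 1)"
  by (simp add: inner_axis' matrix_vector_mul_component inner_axis)

section \<open>The path to an anticommuting involution\<close>

lemma sum_Basis_axis:
  fixes f :: "real ^ 'm \<Rightarrow> real"
  shows "(\<Sum>e\<in>Basis. f e) = (\<Sum>i\<in>UNIV. f (axis i 1))"
proof -
  have B: "(Basis :: (real ^ 'm) set) = range (\<lambda>i. axis i 1)" by (auto simp: Basis_vec_def)
  have "inj (\<lambda>i::'m. axis i (1::real))" by (auto intro!: injI simp: axis_eq_axis)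
  then show ?thesis unfolding B by (simp add: sum.reindex o_def)
qed

lemma path_to_anticommuting:
  fixes S :: "real ^ 'm ^ 'm"
  assumes S: "S \<in> hollow_involutions" and I: "2 * card I = CARD('m)"
  obtains W where "path_component hollow_involutions S W"
    "\<And>x. W *v reflect I x = - reflect I (W *v x)"
proof -
  interpret involution_pair "(*v) S" "reflect I"
    by unfold_locales
      (use hollow_involutionsD[OF S] linear_reflect[of I] in
        \<open>auto simp: symmetric_matrix_inner reflect_inner linear_iff matrix_vector_right_distrib
          matrix_vector_mult_scaleR\<close>)
  have trS: "(\<Sum>e\<in>Basis. e \<bullet> (S *v e)) = 0"
    by (simp add: sum_Basis_axis hollow_involutionsD[OF S] flip: entry_inner_axis)
  have "(\<Sum>e\<in>Basis. e \<bullet> reflect I e) = (\<Sum>i\<in>UNIV. if i \<in> I then 1 else - 1)"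
    unfolding sum_Basis_axis by (rule sum.cong) (auto simp: inner_axis' reflect_def)
  also have "\<dots> = real (card I) - real (card (- I))"
    by (simp add: sum.If_cases Compl_eq)
  also have "\<dots> = 0"
    using I card_Diff_subset[of I UNIV] by (simp add: Compl_eq_Diff_UNIV)
  finally have trJ: "(\<Sum>e\<in>Basis. e \<bullet> reflect I e) = 0" .
  obtain B \<sigma> where fin: "finite B" and orth: "pairwise orthogonal B" and norm1: "\<And>b. b \<in> B \<Longrightarrow> norm b = 1"
    and span: "span B = UNIV"
    and J: "\<And>b. b \<in> B \<Longrightarrow> reflect I b = (b \<bullet> reflect I b) *\<^sub>R b"
    and SB: "\<And>b. b \<in> B \<Longrightarrow> S *v b = (b \<bullet> (S *v b)) *\<^sub>R b + sqrt (1 - (b \<bullet> (S *v b))\<^sup>2) *\<^sub>R \<sigma> b"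
    and le1: "\<And>b. b \<in> B \<Longrightarrow> (b \<bullet> (S *v b))\<^sup>2 \<le> 1"
    and \<sigma>: "\<And>b. b \<in> B \<Longrightarrow> \<sigma> b \<in> B" "\<And>b. b \<in> B \<Longrightarrow> \<sigma> (\<sigma> b) = b"
    and \<sigma>J: "\<And>b. b \<in> B \<Longrightarrow> \<sigma> b \<bullet> reflect I (\<sigma> b) = - (b \<bullet> reflect I b)"
    and \<sigma>S: "\<And>b. b \<in> B \<Longrightarrow> \<sigma> b \<bullet> (S *v \<sigma> b) = - (b \<bullet> (S *v b))"
    using paired_eigenbasis[OF trS trJ] by blast
  define j where "j b = b \<bullet> reflect I b" for b
  define k where "k b = b \<bullet> (S *v b)" for b
  note J = J[folded j_def] and SB = SB[folded k_def] and le1 = le1[folded k_def]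
    and \<sigma>J = \<sigma>J[folded j_def] and \<sigma>S = \<sigma>S[folded k_def]
  \<comment> \<open>The matrix in standard coordinates of the operator sending each \<open>b\<close>
    to \<open>t k b + sqrt (1 - t\<^sup>2 k\<^sup>2) \<sigma>(b)\<close>, written as a sum of outer
    products with the orthonormal \<open>b\<close>.\<close>
  define M :: "real \<Rightarrow> real ^ 'm ^ 'm" where
    "M t = (\<chi> x y. \<Sum>b\<in>B. (t * k b * b $ x + sqrt (1 - (t * k b)\<^sup>2) * \<sigma> b $ x) * b $ y)" for t
  have inner_B: "b \<bullet> c = (if b = c then 1 else 0)" if "b \<in> B" "c \<in> B" for b c
    using that orth norm1 by (auto simp: pairwise_def orthogonal_def dot_square_norm)
  have Mv: "M t *v v = (\<Sum>b\<in>B. (b \<bullet> v) *\<^sub>R ((t * k b) *\<^sub>R b + sqrt (1 - (t * k b)\<^sup>2) *\<^sub>R \<sigma> b))" for t v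
  proof (rule vec_eq_iff[THEN iffD2, rule_format])
    fix x
    have "(M t *v v) $ x = (\<Sum>y\<in>UNIV. \<Sum>b\<in>B. (t * k b * b $ x + sqrt (1 - (t * k b)\<^sup>2) * \<sigma> b $ x) * b $ y * v $ y)"
      by (simp add: M_def matrix_vector_mult_def sum_distrib_right)
    also have "\<dots> = (\<Sum>b\<in>B. \<Sum>y\<in>UNIV. (t * k b * b $ x + sqrt (1 - (t * k b)\<^sup>2) * \<sigma> b $ x) * b $ y * v $ y)"
      by (rule sum.swap)
    also have "\<dots> = (\<Sum>b\<in>B. (b \<bullet> v) * (t * k b * b $ x + sqrt (1 - (t * k b)\<^sup>2) * \<sigma> b $ x))"
      by (simp add: inner_vec_def sum_distrib_right mult_ac)
    finally show "(M t *v v) $ x = (\<Sum>b\<in>B. (b \<bullet> v) *\<^sub>R ((t * k b) *\<^sub>R b + sqrt (1 - (t * k b)\<^sup>2) *\<^sub>R \<sigma> b)) $ x"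
      by simp
  qed
  have MB: "M t *v c = (t * k c) *\<^sub>R c + sqrt (1 - (t * k c)\<^sup>2) *\<^sub>R \<sigma> c" if c: "c \<in> B" for t c
  proof -
    have "M t *v c = (\<Sum>b\<in>B. if b = c then (t * k b) *\<^sub>R b + sqrt (1 - (t * k b)\<^sup>2) *\<^sub>R \<sigma> b else 0)"
      unfolding Mv by (rule sum.cong) (auto simp: inner_B c)
    then show ?thesis using c fin by simp
  qed
  have ext: "f x = g x" if "linear f" "linear g" "\<And>b. b \<in> B \<Longrightarrow> f b = g b" for f g :: "real ^ 'm \<Rightarrow> real ^ 'm" and x
    using linear_eq_on[OF that(1,2), of x B] that(3) span by auto
  have M1: "M 1 = S"
    unfolding matrix_eq
  proof (rule allI, rule ext[of "(*v) (M 1)" "(*v) S"])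
    show "M 1 *v b = S *v b" if "b \<in> B" for b
      using MB[OF that, of 1] SB[OF that] by (simp only: mult_1)
  qed (rule matrix_vector_mul_linear)+
  \<comment> \<open>In the plane of \<open>c\<close> and \<open>\<sigma> c\<close> the operator is
    \<open>[[a, r], [r, -a]]\<close> with \<open>a = t * k c\<close> and
    \<open>a\<^sup>2 + r\<^sup>2 = 1\<close>, a reflection. The bound \<open>t \<le> 1\<close> keeps
    the square root genuine.\<close>
  have invol: "M t *v (M t *v x) = x" if t: "t \<in> {0..1}" for t x
  proof (rule ext[of "\<lambda>x. M t *v (M t *v x)" "\<lambda>x. x"])
    show "linear (\<lambda>x. M t *v (M t *v x))"
      by (simp add: matrix_vector_mul_assoc)
    fix c assume c: "c \<in> B"
    have "(t * k c)\<^sup>2 \<le> 1"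
      using le1[OF c] t mult_mono[of "t\<^sup>2" 1 "(k c)\<^sup>2" 1] by (simp add: power_mult_distrib power_le_one)
    define r where "r = sqrt (1 - (t * k c)\<^sup>2)"
    have Mc: "M t *v c = (t * k c) *\<^sub>R c + r *\<^sub>R \<sigma> c"
      using MB[OF c] by (simp add: r_def)
    have M\<sigma>c: "M t *v \<sigma> c = - (t * k c) *\<^sub>R \<sigma> c + r *\<^sub>R c"
      using MB[OF \<sigma>(1)[OF c]] \<sigma>(2)[OF c] \<sigma>S[OF c] by (simp add: r_def)
    have "r * r = 1 - (t * k c) * (t * k c)"
      using \<open>(t * k c)\<^sup>2 \<le> 1\<close> by (simp add: r_def power2_eq_square)
    moreover have "M t *v (M t *v c) = (t * k c) *\<^sub>R (M t *v c) + r *\<^sub>R (M t *v \<sigma> c)"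
      by (subst Mc) (simp add: matrix_vector_right_distrib matrix_vector_mult_scaleR)
    moreover have "\<dots> = ((t * k c) * (t * k c) + r * r) *\<^sub>R c"
      unfolding Mc M\<sigma>c by (simp add: scaleR_add_right scaleR_diff_right scaleR_add_left mult.commute)
    ultimately show "M t *v (M t *v c) = c" by simp
  qed (rule linear_id[unfolded id_def])
  have sym: "M t $ x $ y = M t $ y $ x" for t x y
  proof -
    \<comment> \<open>Reindexing by \<open>\<sigma>\<close> exchanges \<open>b\<close> and
      \<open>\<sigma> b\<close>; the coefficient depends only on the square of \<open>k b\<close>
      and is unchanged.\<close>
    have "(\<Sum>b\<in>B. sqrt (1 - (t * k b)\<^sup>2) * \<sigma> b $ x * b $ y) = (\<Sum>b\<in>B. sqrt (1 - (t * k b)\<^sup>2) * \<sigma> b $ y * b $ x)"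
      by (rule sum.reindex_bij_witness[of _ \<sigma> \<sigma>]) (auto simp: \<sigma> \<sigma>S)
    then show ?thesis by (simp add: M_def algebra_simps sum.distrib)
  qed
  \<comment> \<open>\<open>b\<close> and \<open>\<sigma> b\<close> have opposite
    \<open>J\<close>-eigenvalues, so one is supported on \<open>I\<close> and the other on its
    complement.\<close>
  have off: "\<sigma> b $ x * b $ x = 0" if b: "b \<in> B" for b x
  proof -
    have "reflect I b $ x = j b * b $ x" "reflect I (\<sigma> b) $ x = - j b * \<sigma> b $ x"
      using arg_cong[OF J[OF b], of "\<lambda>v. v $ x"] arg_cong[OF J[OF \<sigma>(1)[OF b]], of "\<lambda>v. v $ x"] \<sigma>J[OF b]
      by auto
    moreover have "(j b)\<^sup>2 = 1" by (rule J_eigenvalue[OF J[OF b] norm1[OF b]])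
    ultimately show ?thesis by (auto simp: reflect_def power2_eq_1_iff split: if_splits)
  qed
  have diag: "M t $ x $ x = t * (\<Sum>b\<in>B. k b * b $ x * b $ x)" for t x
  proof -
    have "M t $ x $ x = (\<Sum>b\<in>B. t * (k b * b $ x * b $ x) + sqrt (1 - (t * k b)\<^sup>2) * (\<sigma> b $ x * b $ x))"
      by (simp add: M_def algebra_simps)
    also have "\<dots> = (\<Sum>b\<in>B. t * (k b * b $ x * b $ x))"
      by (rule sum.cong) (auto simp: off simp del: mult_eq_0_iff)
    finally show ?thesis by (simp add: sum_distrib_left)
  qed
  \<comment> \<open>The diagonal is linear in \<open>t\<close>, and at \<open>t = 1\<close> it is
    the zero diagonal of \<open>S\<close>.\<close>
  have hollow: "M t $ x $ x = 0" for t x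
    using diag[of 1 x] diag[of t x] hollow_involutionsD(3)[OF S, of x] by (simp add: M1)
  have "continuous_on {0..1} M"
    unfolding M_def by (intro continuous_intros)
  then have "path_component hollow_involutions (M 0) (M 1)"
    unfolding path_component_def
    by (intro exI[of _ M]) (auto simp: path_def path_image_def pathstart_def pathfinish_def
        intro!: hollow_involutionsI sym invol hollow)
  then have "path_component hollow_involutions S (M 0)" by (simp add: M1 path_component_sym)
  \<comment> \<open>At \<open>t = 0\<close> only \<open>b \<mapsto> \<sigma> b\<close> remains, and
    it reverses the \<open>J\<close>-eigenvalue.\<close>
  moreover have "M 0 *v reflect I x = - reflect I (M 0 *v x)" for x
  proof (rule ext[of "\<lambda>x. M 0 *v reflect I x" "\<lambda>x. - reflect I (M 0 *v x)"])
    show "linear (\<lambda>x. M 0 *v reflect I x)"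
      using linear_compose[OF linear_reflect matrix_vector_mul_linear] by (simp add: o_def)
    show "linear (\<lambda>x. - reflect I (M 0 *v x))"
      using linear_compose_neg[OF linear_compose[OF matrix_vector_mul_linear linear_reflect]] by (simp add: o_def)
    fix b assume b: "b \<in> B"
    show "M 0 *v reflect I b = - reflect I (M 0 *v b)"
      using MB[OF b, of 0] J[OF b] J[OF \<sigma>(1)[OF b]] \<sigma>J[OF b]
      by (simp add: matrix_vector_mult_scaleR)
  qed
  ultimately show ?thesis by (rule that)
qed

section \<open>Conjugation by plane rotations\<close>

text \<open>The rotation by \<open>\<theta>\<close> taking \<open>u\<close> towards \<open>w\<close> in their span, for orthonormal \<open>u\<close> and \<open>w\<close>.\<close>
definition rotation :: "real ^ 'm \<Rightarrow> real ^ 'm \<Rightarrow> real \<Rightarrow> real ^ 'm ^ 'm" where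
  "rotation u w \<theta> = (\<chi> x y. (if x = y then 1 else 0) + (cos \<theta> - 1) * (u $ x * u $ y + w $ x * w $ y)
     + sin \<theta> * (w $ x * u $ y - u $ x * w $ y))"

lemma rotation_mult:
  "rotation u w \<theta> *v v = v + ((cos \<theta> - 1) * (u \<bullet> v) - sin \<theta> * (w \<bullet> v)) *\<^sub>R u
     + ((cos \<theta> - 1) * (w \<bullet> v) + sin \<theta> * (u \<bullet> v)) *\<^sub>R w"
proof (rule vec_eq_iff[THEN iffD2, rule_format])
  fix x
  have *: "((if x = y then 1 else 0) + (cos \<theta> - 1) * (u $ x * u $ y + w $ x * w $ y)
     + sin \<theta> * (w $ x * u $ y - u $ x * w $ y)) * v $ y
    = (if x = y then v $ y else 0) + ((cos \<theta> - 1) * u $ x + sin \<theta> * w $ x) * (u $ y * v $ y)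
     + ((cos \<theta> - 1) * w $ x - sin \<theta> * u $ x) * (w $ y * v $ y)" for y
    by (simp add: algebra_simps)
  show "(rotation u w \<theta> *v v) $ x = (v + ((cos \<theta> - 1) * (u \<bullet> v) - sin \<theta> * (w \<bullet> v)) *\<^sub>R u
     + ((cos \<theta> - 1) * (w \<bullet> v) + sin \<theta> * (u \<bullet> v)) *\<^sub>R w) $ x"
    unfolding matrix_vector_mult_def rotation_def
    by (simp add: * sum.distrib inner_vec_def flip: sum_distrib_left) (simp add: algebra_simps)
qed

lemma rotation_fixes: "u \<bullet> v = 0 \<Longrightarrow> w \<bullet> v = 0 \<Longrightarrow> rotation u w \<theta> *v v = v"
  by (simp add: rotation_mult)

lemma transpose_rotation: "transpose (rotation u w \<theta>) = rotation u w (- \<theta>)"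
  by (simp add: rotation_def transpose_def vec_eq_iff algebra_simps)

lemma rotation_minus:
  assumes "u \<bullet> u = 1" "w \<bullet> w = 1" "u \<bullet> w = 0"
  shows "rotation u w \<theta> *v (rotation u w (- \<theta>) *v v) = v"
proof -
  define a b c s where "a = u \<bullet> v" "b = w \<bullet> v" "c = cos \<theta>" "s = sin \<theta>"
  define y where "y = rotation u w (- \<theta>) *v v"
  have y: "y = v + ((c - 1) * a + s * b) *\<^sub>R u + ((c - 1) * b - s * a) *\<^sub>R w"
    by (simp add: y_def rotation_mult a_b_c_s_def)
  have uy: "u \<bullet> y = c * a + s * b" and wy: "w \<bullet> y = c * b - s * a"
    using assms by (simp_all add: y inner_add inner_commute[of w u] flip: a_b_c_s_def) (simp_all add: algebra_simps)
  have cs: "c * c + s * s = 1"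
    using sin_cos_squared_add3[of \<theta>] by (simp add: a_b_c_s_def add.commute)
  have "(c - 1) * a + s * b + ((c - 1) * (c * a + s * b) - s * (c * b - s * a)) = (c * c + s * s - 1) * a"
    by (simp add: algebra_simps)
  then have 1: "(c - 1) * a + s * b + ((c - 1) * (c * a + s * b) - s * (c * b - s * a)) = 0"
    by (simp add: cs)
  have "(c - 1) * b - s * a + ((c - 1) * (c * b - s * a) + s * (c * a + s * b)) = (c * c + s * s - 1) * b"
    by (simp add: algebra_simps)
  then have 2: "(c - 1) * b - s * a + ((c - 1) * (c * b - s * a) + s * (c * a + s * b)) = 0"
    by (simp add: cs)
  have "rotation u w \<theta> *v y = y + ((c - 1) * (c * a + s * b) - s * (c * b - s * a)) *\<^sub>R u
     + ((c - 1) * (c * b - s * a) + s * (c * a + s * b)) *\<^sub>R w"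
    unfolding rotation_mult uy wy by (simp add: a_b_c_s_def)
  also have "\<dots> = v + ((c - 1) * a + s * b + ((c - 1) * (c * a + s * b) - s * (c * b - s * a))) *\<^sub>R u
     + ((c - 1) * b - s * a + ((c - 1) * (c * b - s * a) + s * (c * a + s * b))) *\<^sub>R w"
    by (subst y) (simp only: scaleR_add_left add_ac)
  also have "\<dots> = v" by (simp only: 1 2 scaleR_zero_left add_0_right)
  finally show ?thesis by (simp add: y_def)
qed

text \<open>Conjugation by a rotation preserves symmetry and involutivity, so only the diagonal is
  at stake. Its entries along the path are the quadratic form of \<open>S\<close> at rotated axes,
  which is what \<open>diag\<close> controls for all angles.\<close>

lemma conjugation_path:
  fixes S :: "real ^ 'm ^ 'm"
  assumes S: "S \<in> hollow_involutions" and uw: "u \<bullet> u = 1" "w \<bullet> w = 1" "u \<bullet> w = 0"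
    and diag: "\<And>\<phi> i. (rotation u w \<phi> *v axis i 1) \<bullet> (S *v (rotation u w \<phi> *v axis i 1)) = 0"
  shows "path_component hollow_involutions S (rotation u w \<theta> ** S ** rotation u w (- \<theta>))"
proof -
  define R where "R = rotation u w"
  define M where "M t = R (t * \<theta>) ** S ** R (- (t * \<theta>))" for t
  have RR: "R \<phi> *v (R (- \<phi>) *v x) = x" for \<phi> x
    unfolding R_def by (rule rotation_minus[OF uw])
  then have RR': "R (- \<phi>) *v (R \<phi> *v x) = x" for \<phi> x
    by (metis minus_minus)
  have Mv: "M t *v x = R (t * \<theta>) *v (S *v (R (- (t * \<theta>)) *v x))" for t x
    by (simp add: M_def flip: matrix_vector_mul_assoc)
  have tr: "x \<bullet> (R \<phi> *v y) = (R (- \<phi>) *v x) \<bullet> y" for \<phi> x y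
    by (metis R_def dot_lmul_matrix transpose_rotation vector_transpose_matrix transpose_matrix_vector)
  have inner: "x \<bullet> (M t *v y) = (R (- (t * \<theta>)) *v x) \<bullet> (S *v (R (- (t * \<theta>)) *v y))" for t x y
    by (simp add: Mv tr)
  have mem: "M t \<in> hollow_involutions" for t
  proof (rule hollow_involutionsI)
    show "M t $ x $ y = M t $ y $ x" for x y
      unfolding entry_inner_axis inner
      by (subst symmetric_matrix_inner[OF hollow_involutionsD(1)[OF S]]) (rule inner_commute)
    show "M t *v (M t *v x) = x" for x
      by (simp add: Mv RR RR' hollow_involutionsD(2)[OF S])
    show "M t $ x $ x = 0" for x
      unfolding entry_inner_axis inner by (simp add: R_def diag)
  qed
  have contR: "continuous_on {0..1} (\<lambda>t. R (g t) $ x $ y)" if "continuous_on {0..1} g" for g :: "real \<Rightarrow> real" and x y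
    by (cases "x = y") (auto simp: R_def rotation_def intro!: continuous_intros that)
  have cont: "continuous_on {0..1} M"
    unfolding M_def matrix_matrix_mult_def vec_lambda_beta
    by (intro continuous_on_vec_lambda continuous_on_sum continuous_on_mult contR continuous_on_minus
        continuous_on_const continuous_on_id)
  have "M 0 = S"
    unfolding matrix_eq by (simp add: Mv R_def rotation_mult)
  moreover have "path_component hollow_involutions (M 0) (M 1)"
    unfolding path_component_def using cont
    by (intro exI[of _ M]) (auto simp: path_def path_image_def pathstart_def pathfinish_def mem)
  ultimately show ?thesis by (simp add: M_def R_def)
qed

section \<open>Rotations in the +1 eigenspace of the sign matrix, and alignment with a
  matching\<close>

definition anticommutes :: "real ^ 'm ^ 'm \<Rightarrow> 'm set \<Rightarrow> bool" where
  "anticommutes W I \<longleftrightarrow> (\<forall>x. W *v reflect I x = - reflect I (W *v x))"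

lemma reflect_axis: "reflect I (axis i c) = (if i \<in> I then 1 else - 1) *\<^sub>R axis i c"
  by (auto simp: reflect_def vec_eq_iff axis_def)

lemma reflect_rotation:
  assumes "reflect I u = u" "reflect I w = w"
  shows "reflect I (rotation u w \<theta> *v x) = rotation u w \<theta> *v reflect I x"
  using assms
  by (simp add: rotation_mult reflect_inner linear_add[OF linear_reflect] linear_scale[OF linear_reflect])

text \<open>The rotation commutes with \<open>reflect I\<close>, so a rotated axis \<open>y\<close>
  is still an eigenvector of it, with eigenvalue 1 or -1. Moving \<open>reflect I\<close> across
  \<open>W\<close> then gives \<open>y \<bullet> W y = - (y \<bullet> W y)\<close>, and the diagonal
  stays zero.\<close>

lemma rotation_anticommuting:
  fixes W :: "real ^ 'm ^ 'm"
  assumes W: "W \<in> hollow_involutions" "anticommutes W I"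
    and uw: "u \<bullet> u = 1" "w \<bullet> w = 1" "u \<bullet> w = 0" and I: "reflect I u = u" "reflect I w = w"
  shows "path_component hollow_involutions W (rotation u w \<theta> ** W ** rotation u w (- \<theta>))"
    and "anticommutes (rotation u w \<theta> ** W ** rotation u w (- \<theta>)) I"
proof -
  show "path_component hollow_involutions W (rotation u w \<theta> ** W ** rotation u w (- \<theta>))"
  proof (rule conjugation_path[OF W(1) uw])
    fix \<phi> i
    define y where "y = rotation u w \<phi> *v axis i 1"
    define e :: real where "e = (if i \<in> I then 1 else - 1)"
    have e: "e = 1 \<or> e = -1" "reflect I y = e *\<^sub>R y"
      unfolding y_def reflect_rotation[OF I] reflect_axis
      by (simp_all add: e_def linear_neg[OF matrix_vector_mul_linear])
    have "e * (y \<bullet> (W *v y)) = y \<bullet> (W *v reflect I y)"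
      by (simp add: e(2) matrix_vector_mult_scaleR)
    also have "\<dots> = - (reflect I y \<bullet> (W *v y))"
      using W(2) by (simp add: anticommutes_def reflect_inner)
    also have "\<dots> = - e * (y \<bullet> (W *v y))" by (simp add: e(2))
    finally show "y \<bullet> (W *v y) = 0" using e(1) by auto
  qed
  show "anticommutes (rotation u w \<theta> ** W ** rotation u w (- \<theta>)) I"
    using W(2)
    by (simp add: anticommutes_def reflect_rotation[OF I]  linear_neg[OF matrix_vector_mul_linear]
        flip: matrix_vector_mul_assoc reflect_rotation[OF I])
qed

text \<open>Gram-Schmidt applied to \<open>v\<close> against \<open>u\<close> gives the second
  direction \<open>w\<close>, and \<open>z\<close> replaces it when \<open>v\<close> is
  \<open>u\<close> or \<open>-u\<close>. Expressing \<open>w\<close> through \<open>u\<close>,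
  \<open>v\<close>, \<open>z\<close> lets \<open>w\<close> inherit linear conditions that these
  three satisfy.\<close>

lemma rotation_between:
  fixes u v z :: "'a::real_inner"
  assumes unit: "u \<bullet> u = 1" "v \<bullet> v = 1" "z \<bullet> z = 1" and vz: "v \<bullet> z = 0"
  obtains \<alpha> \<beta> \<gamma> \<theta> w where "w = \<alpha> *\<^sub>R u + \<beta> *\<^sub>R v + \<gamma> *\<^sub>R z" "w \<bullet> w = 1" "u \<bullet> w = 0"
    "v = cos \<theta> *\<^sub>R u + sin \<theta> *\<^sub>R w"
proof -
  define a where "a = u \<bullet> v"
  have n: "(v - a *\<^sub>R u) \<bullet> (v - a *\<^sub>R u) = 1 - a\<^sup>2"
    using unit by (simp add: inner_diff inner_commute[of v u] power2_eq_square flip: a_def)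
  show ?thesis
  proof (cases "a\<^sup>2 = 1")
    case True
    then have va: "v = a *\<^sub>R u" using n by simp
    have uz: "u \<bullet> z = 0" using vz va True by auto
    from True consider "a = 1" | "a = -1" by (auto simp: power2_eq_1_iff)
    then show ?thesis
    proof cases
      case 1
      then show ?thesis using that[of z 0 0 1 0] unit uz va by simp
    next
      case 2
      then show ?thesis using that[of z 0 0 1 pi] unit uz va by simp
    qed
  next
    case False
    have "a\<^sup>2 \<le> 1" using n inner_ge_zero[of "v - a *\<^sub>R u"] by simp
    then have a1: "\<bar>a\<bar> \<le> 1" by (simp add: abs_square_le_1)
    define r where "r = sqrt (1 - a\<^sup>2)"
    have r: "r \<noteq> 0" "r * r = 1 - a\<^sup>2" using False \<open>a\<^sup>2 \<le> 1\<close> by (simp_all add: r_def)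
    define w where "w = (1 / r) *\<^sub>R (v - a *\<^sub>R u)"
    have "w \<bullet> w = 1" using n r False by (simp add: w_def)
    moreover have "u \<bullet> w = 0" using unit by (simp add: w_def inner_diff flip: a_def)
    moreover have "v = cos (arccos a) *\<^sub>R u + sin (arccos a) *\<^sub>R w"
      using a1 r by (simp add: cos_arccos sin_arccos w_def flip: r_def)
    moreover have "w = (- a / r) *\<^sub>R u + (1 / r) *\<^sub>R v + 0 *\<^sub>R z"
      by (simp add: w_def algebra_simps)
    ultimately show ?thesis using that by blast
  qed
qed

lemma reflect_inner_eq_0:
  assumes "reflect I u = u" "reflect I v = - v"
  shows "u \<bullet> v = 0"
  using reflect_inner[of u I v] assms by simp

text \<open>An anticommuting \<open>W\<close> maps the -1 eigenspace of \<open>reflect I\<close>,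
  which contains \<open>axis q 1\<close>, into the +1 eigenspace.\<close>

lemma anticommutes_reflect_column:
  assumes "anticommutes W I" "q \<notin> I"
  shows "reflect I (W *v axis q 1) = W *v axis q 1"
proof -
  have "W *v (- axis q 1) = - reflect I (W *v axis q 1)"
    using assms by (simp add: anticommutes_def reflect_axis flip: assms(1)[unfolded anticommutes_def, rule_format])
  then show ?thesis by (simp add: linear_neg[OF matrix_vector_mul_linear])
qed

text \<open>The index \<open>q\<close> is left out so that \<open>axis (f q) 1\<close> is always a free direction: it allows
  rotating \<open>W e\<^sub>c\<close> onto its target even when the two are antipodal.\<close>
lemma align_with_matching:
  fixes W :: "real ^ 'm ^ 'm"
  assumes W: "W \<in> hollow_involutions" "anticommutes W I"
    and f: "bij_betw f (- I) I" and q: "q \<notin> I" and D: "D \<subseteq> - I - {q}"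
  shows "\<exists>W'. path_component hollow_involutions W W' \<and> anticommutes W' I \<and>
    (\<forall>d\<in>D. W' *v axis d 1 = axis (f d) 1)"
proof -
  have "finite D" by simp
  from this D show ?thesis
  proof (induction D rule: finite_induct)
    case empty
    then show ?case using W by (auto intro!: exI[of _ W] path_component_refl)
  next
    case (insert c D)
    then obtain W' where W': "path_component hollow_involutions W W'" "anticommutes W' I"
      and aligned: "\<And>d. d \<in> D \<Longrightarrow> W' *v axis d 1 = axis (f d) 1" by auto
    have mem: "W' \<in> hollow_involutions" using W'(1) by (rule path_component_mem)
    have c: "c \<notin> I" "c \<noteq> q" and dI: "\<And>d. d \<in> D \<Longrightarrow> d \<notin> I \<and> d \<noteq> q \<and> d \<noteq> c"
      using insert by auto
    have fI: "f d \<in> I" if "d \<notin> I" for d using f that by (auto simp: bij_betw_def)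
    have f_inj: "f d \<noteq> f e" if "d \<notin> I" "e \<notin> I" "d \<noteq> e" for d e
      using f that by (auto simp: bij_betw_def inj_on_def)
    have neg_axis: "reflect I (axis d 1) = - axis d 1" if "d \<notin> I" for d
      using that by (simp add: reflect_axis)
    have isometry: "(W' *v x) \<bullet> (W' *v y) = x \<bullet> y" for x y
      by (simp add: hollow_involutionsD[OF mem] flip: symmetric_matrix_inner[OF hollow_involutionsD(1)[OF mem]])
    define u where "u = W' *v axis c 1"
    define v :: "real ^ 'm" where "v = axis (f c) 1"
    define z :: "real ^ 'm" where "z = axis (f q) 1"
    have u: "u \<bullet> u = 1" by (simp add: u_def isometry inner_axis_axis)
    have v: "v \<bullet> v = 1" and z: "z \<bullet> z = 1" by (simp_all add: v_def z_def inner_axis_axis)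
    have vz: "v \<bullet> z = 0" using f_inj[of c q] c q by (simp add: v_def z_def inner_axis_axis)
    have Iu: "reflect I u = u"
      unfolding u_def by (rule anticommutes_reflect_column[OF W'(2) c(1)])
    have Iv: "reflect I v = v" and Iz: "reflect I z = z"
      using fI c(1) q by (simp_all add: v_def z_def reflect_axis)
    obtain \<alpha> \<beta> \<gamma> \<theta> w where w: "w = \<alpha> *\<^sub>R u + \<beta> *\<^sub>R v + \<gamma> *\<^sub>R z" "w \<bullet> w = 1" "u \<bullet> w = 0"
      and vuw: "v = cos \<theta> *\<^sub>R u + sin \<theta> *\<^sub>R w"
      by (rule rotation_between[OF u v z vz])
    have Iw: "reflect I w = w"
      using Iu Iv Iz unfolding w(1) by (simp add: linear_add[OF linear_reflect] linear_scale[OF linear_reflect])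
    define W'' where "W'' = rotation u w \<theta> ** W' ** rotation u w (- \<theta>)"
    have path: "path_component hollow_involutions W' W''" and anti: "anticommutes W'' I"
      unfolding W''_def using rotation_anticommuting[OF mem W'(2) u w(2,3) Iu Iw] by blast+
    \<comment> \<open>The inner rotation does nothing here: \<open>axis d 1\<close> lies in the -1
      eigenspace, orthogonal to \<open>u\<close> and \<open>w\<close>.\<close>
    have W''_axis: "W'' *v axis d 1 = rotation u w \<theta> *v (W' *v axis d 1)" if "d \<notin> I" for d
      unfolding W''_def
      by (simp add: rotation_fixes reflect_inner_eq_0[OF Iu neg_axis[OF that]]
          reflect_inner_eq_0[OF Iw neg_axis[OF that]] flip: matrix_vector_mul_assoc)
    have "W'' *v axis d 1 = axis (f d) 1" if "d \<in> insert c D" for d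
    proof (cases "d = c")
      case True
      then show ?thesis
        using W''_axis[OF c(1)] u w(3) vuw
        by (simp add: rotation_mult inner_commute[of w u] algebra_simps flip: u_def v_def)
    next
      case False
      with that have d: "d \<in> D" by simp
      \<comment> \<open>Columns aligned earlier are not disturbed: their targets are orthogonal to
        \<open>u\<close> because \<open>W'\<close> is an isometry, to \<open>v\<close> and
        \<open>z\<close> because \<open>f\<close> is injective, and hence to
        \<open>w\<close>.\<close>
      have "u \<bullet> axis (f d) 1 = axis c 1 \<bullet> (axis d 1 :: real ^ 'm)"
        using isometry[of "axis c 1" "axis d 1"] aligned[OF d] by (simp add: u_def)
      then have "u \<bullet> axis (f d) 1 = 0" using False by (simp add: inner_axis_axis)
      moreover have "v \<bullet> axis (f d) 1 = 0" "z \<bullet> axis (f d) 1 = 0"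
        using f_inj[of c d] f_inj[of q d] c q dI[OF d] by (auto simp: v_def z_def inner_axis_axis)
      ultimately have "rotation u w \<theta> *v axis (f d) 1 = axis (f d) 1"
        by (intro rotation_fixes) (simp_all add: w(1) inner_add)
      then show ?thesis using W''_axis[of d] dI[OF d] aligned[OF d] by simp
    qed
    with path_component_trans[OF W'(1) path] anti show ?case by blast
  qed
qed

section \<open>Changing the sign of one edge by quarter-turns in coordinate planes\<close>

lemma quarter_turn_path:
  fixes S :: "real ^ 'm ^ 'm"
  assumes S: "S \<in> hollow_involutions" and ij: "i \<noteq> j" and zero: "S $ i $ j = 0"
  defines "Q \<equiv> rotation (axis i 1) (axis j 1) (pi / 2)"
  obtains S' where "path_component hollow_involutions S S'" "S' \<in> hollow_involutions"
    "S' *v axis i 1 = - (Q *v (S *v axis j 1))" "S' *v axis j 1 = Q *v (S *v axis i 1)"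
    "\<And>k. k \<noteq> i \<Longrightarrow> k \<noteq> j \<Longrightarrow> S' *v axis k 1 = Q *v (S *v axis k 1)"
proof -
  define R where "R = rotation (axis i (1::real)) (axis j 1)"
  have axes: "axis k 1 \<bullet> (axis l 1 :: real ^ 'm) = (if k = l then 1 else 0)" for k l
    by (simp add: inner_axis_axis)
  have Ri: "R \<phi> *v axis i 1 = cos \<phi> *\<^sub>R axis i 1 + sin \<phi> *\<^sub>R axis j 1"
    and Rj: "R \<phi> *v axis j 1 = cos \<phi> *\<^sub>R axis j 1 - sin \<phi> *\<^sub>R axis i 1" for \<phi>
    using ij by (simp_all add: R_def rotation_mult axes algebra_simps)
  have Rk: "R \<phi> *v axis k 1 = axis k 1" if "k \<noteq> i" "k \<noteq> j" for \<phi> k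
    using that by (simp add: R_def rotation_mult axes)
  have ii: "axis k 1 \<bullet> (S *v axis k 1) = 0" for k
    using hollow_involutionsD(3)[OF S] by (simp add: entry_inner_axis)
  have zero': "axis i 1 \<bullet> (S *v axis j 1) = 0" "axis j 1 \<bullet> (S *v axis i 1) = 0"
    using zero symmetric_matrix_inner[OF hollow_involutionsD(1)[OF S], of "axis i 1" "axis j 1"]
    by (simp_all add: entry_inner_axis inner_commute)
  define S' where "S' = R (pi / 2) ** S ** R (- (pi / 2))"
  \<comment> \<open>The quadratic form of \<open>S\<close> at a combination of the axes
    \<open>i\<close> and \<open>j\<close> involves only two diagonal entries and
    \<open>S $ i $ j\<close>, all of which are zero.\<close>
  have diag: "(R \<phi> *v axis k 1) \<bullet> (S *v (R \<phi> *v axis k 1)) = 0" for \<phi> k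
  proof -
    consider "k = i" | "k = j" | "k \<noteq> i" "k \<noteq> j" by blast
    then show ?thesis
    proof cases
      case 1
      then show ?thesis
        by (simp add: Ri matrix_vector_right_distrib matrix_vector_mult_scaleR inner_add ii zero')
    next
      case 2
      then show ?thesis
        by (simp add: Rj matrix_vector_mult_diff_distrib matrix_vector_mult_scaleR inner_diff ii zero')
    next
      case 3
      then show ?thesis by (simp add: Rk ii)
    qed
  qed
  have path: "path_component hollow_involutions S S'"
    unfolding S'_def R_def
    by (rule conjugation_path[OF S _ _ _ diag[unfolded R_def]]) (use ij in \<open>simp_all add: axes\<close>)
  have S'v: "S' *v x = Q *v (S *v (R (- (pi / 2)) *v x))" for x
    by (simp add: S'_def Q_def R_def flip: matrix_vector_mul_assoc)
  have "S' *v axis i 1 = - (Q *v (S *v axis j 1))"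
    unfolding S'v Ri by (simp add: linear_neg[OF matrix_vector_mul_linear])
  moreover have "S' *v axis j 1 = Q *v (S *v axis i 1)"
    unfolding S'v Rj by simp
  moreover have "S' *v axis k 1 = Q *v (S *v axis k 1)" if "k \<noteq> i" "k \<noteq> j" for k
    unfolding S'v Rk[OF that] ..
  ultimately show ?thesis using path path_component_mem(2)[OF path] by (rule_tac that)
qed

lemma quarter_turn_axis:
  assumes "i \<noteq> j"
  shows "rotation (axis i 1) (axis j 1) (pi / 2) *v axis i 1 = axis j 1"
    and "rotation (axis i 1) (axis j 1) (pi / 2) *v axis j 1 = - axis i 1"
    and "k \<noteq> i \<Longrightarrow> k \<noteq> j \<Longrightarrow> rotation (axis i 1) (axis j 1) (pi / 2) *v axis k 1 = axis k 1"
  using assms by (simp_all add: rotation_mult inner_axis_axis)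

text \<open>The three quarter-turns run through the three perfect matchings of the four indices; in terms of
  \<open>[x, y] = x y\<^sup>T + y x\<^sup>T\<close> they take \<open>[p1, q1] + [p2, q2]\<close> to \<open>[p2, q1] - [p1, q2]\<close>, then to
  \<open>- [p1, p2] - [q1, q2]\<close>, and back to \<open>[p1, q1] - [p2, q2]\<close>.\<close>
lemma flip_sign_path:
  fixes S :: "real ^ 'm ^ 'm"
  assumes S: "S \<in> hollow_involutions" and dist: "distinct [p1, p2, q1, q2]"
    and matched: "S *v axis p1 1 = axis q1 1" "S *v axis p2 1 = axis q2 1"
  obtains S' where "path_component hollow_involutions S S'" "S' *v axis q1 1 = axis p1 1"
    "S' *v axis q2 1 = - axis p2 1"
    "\<And>k. k \<notin> {p1, p2, q1, q2} \<Longrightarrow> S' *v axis k 1 = S *v axis k 1"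
proof -
  have matched': "S *v axis q1 1 = axis p1 1" "S *v axis q2 1 = axis p2 1"
    using hollow_involutionsD(2)[OF S] by (metis matched)+
  have neg: "A *v (- x) = - (A *v x)" for A :: "real ^ 'm ^ 'm" and x
    by (simp add: linear_neg[OF matrix_vector_mul_linear])
  note simps = neg quarter_turn_axis entry_inner_axis inner_axis_axis
  have "S $ p1 $ p2 = 0" using dist matched by (auto simp: simps)
  then obtain S1 where p1: "path_component hollow_involutions S S1" and S1: "S1 \<in> hollow_involutions"
    and "S1 *v axis p1 1 = - (rotation (axis p1 1) (axis p2 1) (pi / 2) *v (S *v axis p2 1))"
    and "S1 *v axis p2 1 = rotation (axis p1 1) (axis p2 1) (pi / 2) *v (S *v axis p1 1)"
    and S1k: "\<And>k. k \<noteq> p1 \<Longrightarrow> k \<noteq> p2 \<Longrightarrow>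
      S1 *v axis k 1 = rotation (axis p1 1) (axis p2 1) (pi / 2) *v (S *v axis k 1)"
    using quarter_turn_path[OF S, of p1 p2] dist by auto
  then have S1v: "S1 *v axis p1 1 = - axis q2 1" "S1 *v axis p2 1 = axis q1 1"
    "S1 *v axis q1 1 = axis p2 1" "S1 *v axis q2 1 = - axis p1 1"
    using dist matched matched' by (auto simp: simps)
  have "S1 $ p1 $ q1 = 0" using dist S1v by (auto simp: simps)
  then obtain S2 where p2: "path_component hollow_involutions S1 S2" and S2: "S2 \<in> hollow_involutions"
    and "S2 *v axis p1 1 = - (rotation (axis p1 1) (axis q1 1) (pi / 2) *v (S1 *v axis q1 1))"
    and "S2 *v axis q1 1 = rotation (axis p1 1) (axis q1 1) (pi / 2) *v (S1 *v axis p1 1)"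
    and S2k: "\<And>k. k \<noteq> p1 \<Longrightarrow> k \<noteq> q1 \<Longrightarrow>
      S2 *v axis k 1 = rotation (axis p1 1) (axis q1 1) (pi / 2) *v (S1 *v axis k 1)"
    using quarter_turn_path[OF S1, of p1 q1] dist by auto
  then have S2v: "S2 *v axis p1 1 = - axis p2 1" "S2 *v axis q1 1 = - axis q2 1"
    "S2 *v axis p2 1 = - axis p1 1" "S2 *v axis q2 1 = - axis q1 1"
    using dist S1v by (auto simp: simps)
  have "S2 $ p1 $ q2 = 0" using dist S2v by (auto simp: simps)
  then obtain S3 where p3: "path_component hollow_involutions S2 S3" and S3: "S3 \<in> hollow_involutions"
    and "S3 *v axis p1 1 = - (rotation (axis p1 1) (axis q2 1) (pi / 2) *v (S2 *v axis q2 1))"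
    and "S3 *v axis q2 1 = rotation (axis p1 1) (axis q2 1) (pi / 2) *v (S2 *v axis p1 1)"
    and S3k: "\<And>k. k \<noteq> p1 \<Longrightarrow> k \<noteq> q2 \<Longrightarrow>
      S3 *v axis k 1 = rotation (axis p1 1) (axis q2 1) (pi / 2) *v (S2 *v axis k 1)"
    using quarter_turn_path[OF S2, of p1 q2] dist by auto
  then have S3v: "S3 *v axis q1 1 = axis p1 1" "S3 *v axis q2 1 = - axis p2 1"
    using dist S2v by (auto simp: simps)
  have others: "S3 *v axis k 1 = S *v axis k 1" if k: "k \<notin> {p1, p2, q1, q2}" for k
  proof -
    \<comment> \<open>\<open>S\<close> permutes the four axes, so by symmetry it maps every other
      axis to a vector orthogonal to all four; the three rotations fix such a vector.\<close>
    have orth: "axis a 1 \<bullet> (S *v axis k 1) = 0" if "a \<in> {p1, p2, q1, q2}" for a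
    proof -
      have "axis a 1 \<bullet> (S *v axis k 1) = (S *v axis a 1) \<bullet> axis k 1"
        by (rule symmetric_matrix_inner[OF hollow_involutionsD(1)[OF S]])
      then show ?thesis using that k by (auto simp: matched matched' inner_axis_axis)
    qed
    then show ?thesis using k by (simp add: S1k S2k S3k rotation_fixes)
  qed
  show ?thesis
    using that[OF path_component_trans[OF path_component_trans[OF p1 p2] p3] S3v others] .
qed

section \<open>Path-connectedness of the hollow involutions\<close>

lemma matrix_eq_axis:
  fixes A B :: "real ^ 'm ^ 'm"
  assumes "\<And>k. A *v axis k 1 = B *v axis k 1"
  shows "A = B"
  by (simp add: vec_eq_iff entry_inner_axis assms)

text \<open>Every hollow involution is joined to one and the same matrix: the matching
  \<open>f\<close> with a negative sign on the edge at \<open>q2\<close>. The assumption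
  \<open>n > 1\<close> supplies the second edge, at \<open>q1\<close>, that is needed to change that
  sign.\<close>

lemma path_connected_hollow_involutions:
  assumes n: "n > 1" and card: "CARD('m::finite) = 2 * n"
  shows "path_connected (hollow_involutions :: (real ^ 'm ^ 'm) set)"
proof -
  obtain I :: "'m set" where I: "card I = n"
    using obtain_subset_with_card_n[of n "UNIV :: 'm set"] card by auto
  have cI: "card (- I) = n"
    using I card card_Diff_subset[of I UNIV] by (simp add: Compl_eq_Diff_UNIV)
  obtain f where f: "bij_betw f (- I) I"
    using finite_same_card_bij[of "- I" I] I cI by auto
  obtain q1 q2 where q: "q1 \<notin> I" "q2 \<notin> I" "q1 \<noteq> q2"
  proof -
    have "\<not> card (- I) \<le> Suc 0" using cI n by simp
    then show ?thesis using that by (auto simp: card_le_Suc0_iff_eq)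
  qed
  have fI: "f d \<in> I" if "d \<notin> I" for d using f that by (auto simp: bij_betw_def)
  have f_inj: "f d \<noteq> f e" if "d \<notin> I" "e \<notin> I" "d \<noteq> e" for d e
    using f that by (auto simp: bij_betw_def inj_on_def)
  define target where "target W \<longleftrightarrow> (\<forall>d. d \<notin> I \<longrightarrow> d \<noteq> q2 \<longrightarrow> W *v axis d 1 = axis (f d) 1) \<and>
      W *v axis q2 1 = - axis (f q2) 1" for W :: "real ^ 'm ^ 'm"
  have to_target: "\<exists>W. path_component hollow_involutions S W \<and> target W"
    if S: "S \<in> hollow_involutions" for S
  proof -
    obtain W0 where W0: "path_component hollow_involutions S W0" "anticommutes W0 I"
      using path_to_anticommuting[OF S, of I] I card unfolding anticommutes_def by metis
    obtain W where "path_component hollow_involutions W0 W" and anti: "anticommutes W I"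
      and W: "\<And>d. d \<notin> I \<Longrightarrow> d \<noteq> q2 \<Longrightarrow> W *v axis d 1 = axis (f d) 1"
      using align_with_matching[OF path_component_mem(2)[OF W0(1)] W0(2) f q(2) order_refl] by auto
    with W0 have path: "path_component hollow_involutions S W" by (blast intro: path_component_trans)
    then have mem: "W \<in> hollow_involutions" by (rule path_component_mem)
    note sym = symmetric_matrix_inner[OF hollow_involutionsD(1)[OF mem]]
    define u where "u = W *v axis q2 1"
    have uu: "u \<bullet> u = 1"
      by (simp add: u_def hollow_involutionsD[OF mem] inner_axis_axis flip: sym)
    have "reflect I u = u"
      unfolding u_def by (rule anticommutes_reflect_column[OF anti q(2)])
    \<comment> \<open>The last column is forced up to sign: it is orthogonal to the aligned columns,
      which are the other axes in \<open>I\<close>, and being fixed by \<open>reflect I\<close> it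
      vanishes outside \<open>I\<close>.\<close>
    have u_comp: "u $ i = 0" if "i \<noteq> f q2" for i
    proof (cases "i \<in> I")
      case True
      then obtain d where d: "d \<notin> I" "i = f d" using f by (auto simp: bij_betw_def)
      then have "d \<noteq> q2" using that by auto
      have "u $ i = (W *v axis q2 1) \<bullet> (W *v axis d 1)"
        using W[OF d(1) \<open>d \<noteq> q2\<close>] d(2) by (simp add: u_def inner_axis)
      also have "\<dots> = 0"
        using \<open>d \<noteq> q2\<close> by (simp add: hollow_involutionsD[OF mem] inner_axis_axis flip: sym)
      finally show ?thesis .
    next
      case False
      have "reflect I u $ i = - u $ i" using False by (simp add: reflect_def)
      then show ?thesis using \<open>reflect I u = u\<close> by simp
    qed
    then have u_axis: "u = u $ f q2 *\<^sub>R axis (f q2) 1"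
      by (auto simp: vec_eq_iff axis_def)
    have "(u $ f q2)\<^sup>2 = 1"
      using uu by (subst (asm) (1 2) u_axis) (simp add: inner_axis_axis power2_eq_square)
    then consider "u = axis (f q2) 1" | "u = - axis (f q2) 1"
      using u_axis by (auto simp: power2_eq_1_iff)
    then show ?thesis
    proof cases
      case 1
      have "W *v axis (f q1) 1 = axis q1 1" "W *v axis (f q2) 1 = axis q2 1"
        using W[OF q(1,3)] 1 hollow_involutionsD(2)[OF mem] unfolding u_def by metis+
      moreover have "distinct [f q1, f q2, q1, q2]"
        using q fI[of q1] fI[of q2] f_inj[of q1 q2] by auto
      ultimately obtain W' where W': "path_component hollow_involutions W W'"
        "W' *v axis q1 1 = axis (f q1) 1" "W' *v axis q2 1 = - axis (f q2) 1"
        "\<And>k. k \<notin> {f q1, f q2, q1, q2} \<Longrightarrow> W' *v axis k 1 = W *v axis k 1"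
        using flip_sign_path[OF mem] by blast
      have "W' *v axis d 1 = axis (f d) 1" if "d \<notin> I" "d \<noteq> q2" for d
      proof (cases "d = q1")
        case False
        then have "d \<notin> {f q1, f q2, q1, q2}" using that fI[OF q(1)] fI[OF q(2)] by auto
        then show ?thesis using W'(4) W that by simp
      qed (simp add: W')
      then have "target W'" using W' by (simp add: target_def)
      then show ?thesis using path_component_trans[OF path W'(1)] by blast
    next
      case 2
      then have "target W" using W by (simp add: target_def u_def)
      then show ?thesis using path by blast
    qed
  qed
  have unique: "A = B" if "A \<in> hollow_involutions" "B \<in> hollow_involutions" "target A" "target B"
    for A B :: "real ^ 'm ^ 'm"
  proof (rule matrix_eq_axis)
    \<comment> \<open>The columns outside \<open>I\<close> determine the remaining ones, since an
      involution undoes the matching with the same signs.\<close>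
    have on_I: "C *v axis (f d) 1 = (if d = q2 then - axis d 1 else axis d 1)"
      if C: "C \<in> hollow_involutions" "target C" and d: "d \<notin> I" for C :: "real ^ 'm ^ 'm" and d
    proof -
      have "axis (f d) 1 = C *v (if d = q2 then - axis d 1 else axis d 1)"
        using C(2) d by (simp add: target_def linear_neg[OF matrix_vector_mul_linear])
      then show ?thesis using hollow_involutionsD(2)[OF C(1)] by metis
    qed
    show "A *v axis k 1 = B *v axis k 1" for k
    proof (cases "k \<in> I")
      case True
      then obtain d where "d \<notin> I" "k = f d" using f by (auto simp: bij_betw_def)
      then show ?thesis using on_I that by simp
    next
      case False
      then show ?thesis using that(3,4) by (cases "k = q2") (simp_all add: target_def)
    qed
  qed
  show ?thesis
    unfolding path_connected_component
  proof (intro ballI)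
    fix S T :: "real ^ 'm ^ 'm"
    assume "S \<in> hollow_involutions" "T \<in> hollow_involutions"
    then obtain A B where A: "path_component hollow_involutions S A" "target A"
      and B: "path_component hollow_involutions T B" "target B"
      using to_target by metis
    have "A = B"
      using unique A(2) B(2) path_component_mem(2)[OF A(1)] path_component_mem(2)[OF B(1)] by blast
    then show "path_component hollow_involutions S T"
      using A(1) B(1) path_component_sym path_component_trans by blast
  qed
qed

section \<open>From involutions back to projections\<close>

lemma half_diag_projections_eq:
  "half_diag_projections = (\<lambda>S. (1/2) *\<^sub>R (mat 1 + S)) ` (hollow_involutions :: (real ^ 'm ^ 'm) set)"
proof (intro subset_antisym subsetI)
  fix p :: "real ^ 'm ^ 'm" assume "p \<in> half_diag_projections"
  then have p: "transpose p = p" "p ** p = p" "\<And>i. p $ i $ i = 1 / 2"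
    by (auto simp: half_diag_projections_def is_projection_def)
  define S where "S = 2 *\<^sub>R p - mat 1"
  have Sv: "S *v x = 2 *\<^sub>R (p *v x) - x" for x
    by (simp add: S_def matrix_vector_mult_diff_rdistrib scaleR_matrix_vector_assoc)
  have pp: "p *v (p *v x) = p *v x" for x by (simp add: matrix_vector_mul_assoc p)
  have "S \<in> hollow_involutions"
  proof (rule hollow_involutionsI)
    show "S $ x $ y = S $ y $ x" for x y
      using arg_cong[OF p(1), of "\<lambda>M. M $ x $ y"] by (simp add: S_def transpose_def mat_def)
    show "S *v (S *v x) = x" for x
    proof -
      have "p *v (S *v x) = p *v x"
        by (simp only: Sv matrix_vector_mult_diff_distrib matrix_vector_right_distrib pp scaleR_2
            add_diff_cancel_right')
      then show ?thesis by (simp only: Sv[of "S *v x"]) (simp only: Sv diff_diff_eq2 add_diff_cancel_left')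
    qed
    show "S $ x $ x = 0" for x by (simp add: S_def mat_def p(3))
  qed
  moreover have "p = (1/2) *\<^sub>R (mat 1 + S)" by (simp add: S_def)
  ultimately show "p \<in> (\<lambda>S. (1/2) *\<^sub>R (mat 1 + S)) ` hollow_involutions" by blast
next
  fix p :: "real ^ 'm ^ 'm" assume "p \<in> (\<lambda>S. (1/2) *\<^sub>R (mat 1 + S)) ` hollow_involutions"
  then obtain S where S: "S \<in> hollow_involutions" and p: "p = (1/2) *\<^sub>R (mat 1 + S)" by blast
  have pv: "p *v x = (1/2) *\<^sub>R (x + S *v x)" for x
    by (simp add: p matrix_vector_mult_add_rdistrib flip: scaleR_matrix_vector_assoc)
  have "transpose p = p"
    unfolding vec_eq_iff
  proof (intro allI)
    fix x y
    show "transpose p $ x $ y = p $ x $ y"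
      using arg_cong[OF hollow_involutionsD(1)[OF S], of "\<lambda>M. M $ x $ y"]
      by (simp add: p transpose_def mat_def)
  qed
  moreover have "p ** p = p"
    unfolding matrix_eq
  proof (intro allI)
    fix x
    \<comment> \<open>Since \<open>S\<close> squares to the identity, \<open>p ** p\<close> is
      \<open>(1 + 2 S + 1) / 4\<close>, hence the two quarters.\<close>
    have "(p ** p) *v x = (1/4 + 1/4) *\<^sub>R (x + S *v x)"
      unfolding scaleR_add_left
      by (simp add: pv matrix_vector_right_distrib matrix_vector_mult_scaleR hollow_involutionsD[OF S]
          algebra_simps flip: matrix_vector_mul_assoc)
    then show "(p ** p) *v x = p *v x" by (simp add: pv)
  qed
  moreover have "p $ i $ i = 1 / 2" for i
    using hollow_involutionsD(3)[OF S] by (simp add: p mat_def)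
  ultimately show "p \<in> half_diag_projections"
    by (simp add: half_diag_projections_def is_projection_def)
qed

text \<open>With off-diagonal entry \<open>a\<close>, idempotence reduces to the diagonal condition
  \<open>1/4 + a\<^sup>2 = 1/2\<close>, so \<open>a\<close> is \<open>1/2\<close> or
  \<open>-1/2\<close>.\<close>

lemma half_diag_projections_2:
  "(half_diag_projections :: (real ^ 2 ^ 2) set) =
    {\<chi> i j. 1 / 2, \<chi> i j. if i = j then 1 / 2 else - 1 / 2}"
proof -
  have mem: "p \<in> half_diag_projections \<longleftrightarrow>
      p $ 1 $ 1 = 1 / 2 \<and> p $ 2 $ 2 = 1 / 2 \<and> p $ 1 $ 2 = p $ 2 $ 1 \<and> (p $ 1 $ 2 = 1 / 2 \<or> p $ 1 $ 2 = - 1 / 2)"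
    for p :: "real ^ 2 ^ 2"
  proof -
    have root: "a * a = 1 / 4 \<longleftrightarrow> a = 1 / 2 \<or> a = - 1 / 2" for a :: real
      using square_eq_iff[of a "1 / 2"] by simp
    have "p = transpose p \<longleftrightarrow> p $ 1 $ 2 = p $ 2 $ 1"
      by (auto simp: vec_eq_iff forall_2 transpose_def)
    moreover have "transpose p = p ** p \<longleftrightarrow> p $ 1 $ 2 = 1 / 2 \<or> p $ 1 $ 2 = - 1 / 2"
      if "p $ 1 $ 1 = 1 / 2" "p $ 2 $ 2 = 1 / 2" "p $ 2 $ 1 = p $ 1 $ 2"
    proof -
      have "transpose p = p ** p \<longleftrightarrow> p $ 1 $ 2 * p $ 1 $ 2 = 1 / 4"
        by (simp add: vec_eq_iff forall_2 transpose_def matrix_matrix_mult_def sum_2 that) argo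
      then show ?thesis by (simp only: root)
    qed
    ultimately show ?thesis
      unfolding half_diag_projections_def is_projection_def mem_Collect_eq forall_2 by metis
  qed
  show ?thesis
    by (rule set_eqI, unfold mem) (simp add: vec_eq_iff forall_2, argo)
qed

theorem mainTheorem3:
  shows "\<not> connected (half_diag_projections :: (real ^ 2 ^ 2) set)
    \<and> (\<forall>n::nat. n > 1 \<longrightarrow> CARD('m::finite) = 2 * n \<longrightarrow>
          path_connected (half_diag_projections :: (real ^ 'm ^ 'm) set))"
proof (intro conjI allI impI)
  have two_points: "A \<noteq> B \<Longrightarrow> \<not> connected {A, B}" for A B :: "real ^ 2 ^ 2"
    using connected_finite_iff_sing[of "{A, B}"] by (auto simp: doubleton_eq_iff)
  have "(\<chi> i j. 1 / 2) \<noteq> ((\<chi> i j. if i = j then 1 / 2 else - 1 / 2) :: real ^ 2 ^ 2)"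
    by (simp add: vec_eq_iff forall_2)
  then show "\<not> connected (half_diag_projections :: (real ^ 2 ^ 2) set)"
    unfolding half_diag_projections_2 by (rule two_points)
next
  fix n :: nat
  assume "n > 1" "CARD('m) = 2 * n"
  then have "path_connected (hollow_involutions :: (real ^ 'm ^ 'm) set)"
    by (rule path_connected_hollow_involutions)
  then show "path_connected (half_diag_projections :: (real ^ 'm ^ 'm) set)"
    unfolding half_diag_projections_eq
    by (intro path_connected_continuous_image continuous_intros)
qed

end
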